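(* Let $d\ge2$ and fix $\lambda,r>0$. Then \begin{enumerate} \item $\mu_c(\lambda,r)\ge \lambda_c(r)-\lambda$, if $\lambda_c(2r)<\lambda<\lambda_c(r)$; and \item $\mu_c(\lambda,r)=\infty$, if $\lambda<\lambda_c(2r)$. \end{enumerate}
   Context: Let $\Phi^{(1)}$ and $\Phi^{(2)}$ be independent homogeneous Poisson point processes in $\mathbb{R}^d$, $d\ge2$, with intensities $\lambda>0$ and $\mu>0$ respectively; $|\cdot|$ is the Euclidean norm. A graph percolates if it contains an infinite connected component. For $\rho>0$, the continuum percolation model $\tilde G(\lambda,\rho)$ is the graph with vertex set $\Phi^{(1)}$ and an (undirected) edge between distinct $X_i,X_j\in\Phi^{(1)}$ whenever $|X_i-X_j|\le 2\rho$. Its critical intensity is $\lambda_c(\rho):=\sup\{\lambda>0: \mathsf{P}(\tilde G(\lambda,\rho)\text{ percolates})=0\}$. The continuum $AB$ percolation model $G(\lambda,\mu,r)$ is the graph with vertex set $\Phi^{(1)}$ and an edge between distinct $X_i,X_j\in\Phi^{(1)}$ whenever there is some $Y\in\Phi^{(2)}$ with $|X_i-Y|\le 2r$ and $|X_j-Y|\le 2r$. Let $\theta(\lambda,\mu,r)=\mathsf{P}(G(\lambda,\mu,r)\text{ percolates})$ and, for fixed $\lambda,r>0$, define $\mu_c(\lambda,r):=\sup\{\mu>0:\theta(\lambda,\mu,r)=0\}$. *)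

theory Defs
  imports "HOL-Probability.Probability"
begin

section \<open>Point configurations and Poisson point processes\<close>

definition locally_finite :: "'a::metric_space set \<Rightarrow> bool" where
  "locally_finite \<phi> \<longleftrightarrow> (\<forall>B. bounded B \<longrightarrow> finite (\<phi> \<inter> B))"

definition bounded_borel :: "'a::metric_space set set" where
  "bounded_borel = {B \<in> sets borel. bounded B}"

text \<open>
  The space of locally finite configurations, with the \<open>\<sigma>\<close>-algebra generated by the counts
  in bounded Borel sets. Configurations are sets rather than counting measures:
  a homogeneous Poisson process is almost surely simple.
\<close>

definition config_space :: "'a::euclidean_space set measure" where
  "config_space =
     sigma {\<phi>. locally_finite \<phi>}
       {{\<phi>. locally_finite \<phi> \<and> card (\<phi> \<inter> B) = k} | B k. B \<in> bounded_borel}"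

text \<open>
  The Poisson weights are written out because the library's \<open>poisson_pmf\<close> is only specified for
  a positive rate, and \<open>B\<close> may be a Lebesgue null set (then \<open>0 ^ 0 = 1\<close> gives the Dirac mass at 0).
\<close>

definition poisson_process ::
  "'w measure \<Rightarrow> real \<Rightarrow> ('w \<Rightarrow> 'a::euclidean_space set) \<Rightarrow> bool" where
  "poisson_process M lam \<Phi> \<longleftrightarrow>
     prob_space M \<and>
     \<Phi> \<in> M \<rightarrow>\<^sub>M config_space \<and>
     (\<forall>B\<in>bounded_borel. \<forall>k.
        measure M {\<omega> \<in> space M. card (\<Phi> \<omega> \<inter> B) = k} =
          (lam * measure lborel B) ^ k / fact k * exp (- (lam * measure lborel B))) \<and>
     (\<forall>\<B>. \<B> \<subseteq> bounded_borel \<and> disjoint \<B> \<longrightarrow>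
        prob_space.indep_vars M (\<lambda>_. count_space UNIV) (\<lambda>B \<omega>. card (\<Phi> \<omega> \<inter> B)) \<B>)"

text \<open>
  The distribution of the homogeneous Poisson process of intensity \<open>lam\<close>, as a measure on
  configurations: the unique law under which the canonical (identity) process is Poisson.
\<close>

definition poisson_law :: "real \<Rightarrow> 'a::euclidean_space set measure" where
  "poisson_law lam =
     (THE N. sets N = sets config_space \<and> poisson_process N lam (\<lambda>\<phi>. \<phi>))"

section \<open>Percolation in graphs\<close>

text \<open>
  The edge sets below are symmetric, so \<open>E\<^sup>* `` {x}\<close> is the connected component of \<open>x\<close>.
\<close>

definition percolates :: "'a set \<Rightarrow> ('a \<times> 'a) set \<Rightarrow> bool" where
  "percolates V E \<longleftrightarrow> (\<exists>x\<in>V. infinite (E\<^sup>* `` {x}))"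

definition boolean_edges :: "'a::metric_space set \<Rightarrow> real \<Rightarrow> ('a \<times> 'a) set" where
  "boolean_edges \<phi> \<rho> = {(x, y). x \<in> \<phi> \<and> y \<in> \<phi> \<and> x \<noteq> y \<and> dist x y \<le> 2 * \<rho>}"

definition ab_edges :: "'a::metric_space set \<Rightarrow> 'a set \<Rightarrow> real \<Rightarrow> ('a \<times> 'a) set" where
  "ab_edges \<phi> \<psi> r =
     {(x, y). x \<in> \<phi> \<and> y \<in> \<phi> \<and> x \<noteq> y \<and> (\<exists>z\<in>\<psi>. dist x z \<le> 2 * r \<and> dist y z \<le> 2 * r)}"

section \<open>Percolation probabilities and critical intensities\<close>

text \<open>
  Probabilities of percolation events are taken as outer measures, which agree with the measure
  on measurable sets; this avoids the convention that \<open>emeasure\<close> is 0 on non-measurable sets.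
  The argument of type \<open>'a itself\<close> carries the ambient Euclidean space.
\<close>

definition boolean_perc_prob :: "'a::euclidean_space itself \<Rightarrow> real \<Rightarrow> real \<Rightarrow> ennreal" where
  "boolean_perc_prob _ lam \<rho> =
     outer_measure_of (poisson_law lam)
       {\<phi> :: 'a set. locally_finite \<phi> \<and> percolates \<phi> (boolean_edges \<phi> \<rho>)}"

definition lambda_c :: "'a::euclidean_space itself \<Rightarrow> real \<Rightarrow> ereal" where
  "lambda_c T \<rho> = Sup {ereal lam | lam. lam > 0 \<and> boolean_perc_prob T lam \<rho> = 0}"

text \<open>Independence of the two processes is expressed by the product of their laws.\<close>

definition ab_perc_prob :: "'a::euclidean_space itself \<Rightarrow> real \<Rightarrow> real \<Rightarrow> real \<Rightarrow> ennreal" where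
  "ab_perc_prob _ lam \<mu> r =
     outer_measure_of (poisson_law lam \<Otimes>\<^sub>M poisson_law \<mu>)
       {(\<phi> :: 'a set, \<psi> :: 'a set).
          locally_finite \<phi> \<and> locally_finite \<psi> \<and> percolates \<phi> (ab_edges \<phi> \<psi> r)}"

definition mu_c :: "'a::euclidean_space itself \<Rightarrow> real \<Rightarrow> real \<Rightarrow> ereal" where
  "mu_c T lam r = Sup {ereal \<mu> | \<mu>. \<mu> > 0 \<and> ab_perc_prob T lam \<mu> r = 0}"

end

theory Submission
  imports Defs
begin

text \<open>
  Superposing independent Poisson processes of intensities \<open>\<lambda>\<close> and \<open>\<mu>\<close> gives one of intensity
  \<open>\<lambda> + \<mu>\<close>. An edge of the \<open>AB\<close> graph becomes a path of length at most two through its witness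
  in the continuum graph of radius \<open>r\<close> on the superposition, so \<open>AB\<close> percolation is null as soon
  as \<open>\<lambda> + \<mu>\<close> is a non-percolating intensity for radius \<open>r\<close>; it is also an edge of the continuum
  graph of radius \<open>2 r\<close> on the first process alone, which gives the second claim. There one needs
  that non-percolation passes to smaller intensities, again by superposition and Fubini.

  All statements about laws go through void probabilities. The events \<open>\<phi> \<inter> B = {}\<close> form a
  \<open>\<inter>\<close>-stable generator of the configuration space, and by Renyi's theorem a law with
  \<open>P (\<phi> \<inter> B = {}) = exp (- \<lambda> |B|)\<close> for all bounded Borel \<open>B\<close> is Poisson. This makes
  superposition a product of exponentials, without treating coinciding points.
\<close>

section \<open>Void events\<close>

definition void_event :: "'a::metric_space set \<Rightarrow> 'a set set" where
  "void_event B = {\<phi>. locally_finite \<phi> \<and> \<phi> \<inter> B = {}}"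

lemma void_event_empty: "void_event {} = {\<phi>. locally_finite \<phi>}"
  by (auto simp: void_event_def)

lemma void_event_Un: "void_event (A \<union> B) = void_event A \<inter> void_event B"
  by (auto simp: void_event_def)

lemma void_event_UN:
  "I \<noteq> {} \<Longrightarrow> void_event (\<Union>i\<in>I. A i) = (\<Inter>i\<in>I. void_event (A i))"
  by (auto simp: void_event_def)

lemma locally_finite_empty: "locally_finite {}"
  by (simp add: locally_finite_def)

lemma locally_finite_Un: "locally_finite A \<Longrightarrow> locally_finite B \<Longrightarrow> locally_finite (A \<union> B)"
  by (simp add: locally_finite_def Int_Un_distrib2)

lemma locally_finite_finite: "finite A \<Longrightarrow> locally_finite A"
  by (simp add: locally_finite_def)

lemma locally_finiteD: "locally_finite A \<Longrightarrow> B \<in> bounded_borel \<Longrightarrow> finite (A \<inter> B)"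
  by (simp add: locally_finite_def bounded_borel_def)

lemma space_config_space: "space config_space = {\<phi>::'a::euclidean_space set. locally_finite \<phi>}"
  unfolding config_space_def by (subst space_measure_of) auto

lemma sets_config_space:
  "sets config_space = sigma_sets {\<phi>::'a::euclidean_space set. locally_finite \<phi>}
     {{\<phi>. locally_finite \<phi> \<and> card (\<phi> \<inter> B) = k} | B k. B \<in> bounded_borel}"
  unfolding config_space_def by (subst sets_measure_of) auto

section \<open>Void events generate the configuration sigma-algebra and determine a law\<close>

lemma finite_separated_by_basis:
  fixes S :: "'a::metric_space set"
  assumes "finite S" and basis: "topological_basis \<C>"
  obtains U where "\<And>x. x \<in> S \<Longrightarrow> x \<in> U x" "U ` S \<subseteq> \<C>"
    "\<And>x y. x \<in> S \<Longrightarrow> y \<in> S \<Longrightarrow> x \<noteq> y \<Longrightarrow> U x \<inter> U y = {}"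
proof -
  define D where "D = (\<lambda>(x, y). dist x y) ` {(x, y) \<in> S \<times> S. x \<noteq> y}"
  have "finite {(x, y) \<in> S \<times> S. x \<noteq> y}"
    by (rule finite_subset[of _ "S \<times> S"]) (use assms in auto)
  then have "finite D"
    by (simp add: D_def)
  \<comment> \<open>The extra element 1 keeps the minimum defined and positive when \<open>S\<close>
    has fewer than two points.\<close>
  define d where "d = Min (insert 1 D)"
  have "d > 0"
    unfolding d_def using \<open>finite D\<close> by (subst Min_gr_iff) (auto simp: D_def)
  have d: "d \<le> dist x y" if "x \<in> S" "y \<in> S" "x \<noteq> y" for x y
    unfolding d_def using \<open>finite D\<close> that by (intro Min_le) (auto simp: D_def image_iff)
  have "\<exists>W\<in>\<C>. x \<in> W \<and> W \<subseteq> ball x (d / 2)" for x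
    using topological_basisE[OF basis open_ball, of x x "d/2"] \<open>d > 0\<close> by auto
  then obtain U where U: "\<And>x. U x \<in> \<C>" "\<And>x. x \<in> U x" "\<And>x. U x \<subseteq> ball x (d / 2)"
    by metis
  show thesis
  proof
    fix x y assume xy: "x \<in> S" "y \<in> S" "x \<noteq> y"
    have False if "z \<in> U x" "z \<in> U y" for z
    proof -
      have "dist x z < d / 2" "dist y z < d / 2"
        using U(3)[of x] U(3)[of y] that by auto
      then have "dist x y < d"
        by metric
      with d[OF xy] show False by simp
    qed
    then show "U x \<inter> U y = {}" by auto
  qed (use U in auto)
qed

text \<open>Turns counting points into hitting sets. A finite set is separated by small basis
  elements; conversely, one point chosen from each of \<open>k\<close> disjoint sets gives
  \<open>k\<close> different points. For a countable basis the existential ranges over a countable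
  family.\<close>

lemma card_ge_iff_basis:
  fixes S :: "'a::metric_space set"
  assumes "finite S" and basis: "topological_basis \<C>"
  shows "k \<le> card S \<longleftrightarrow> (\<exists>F. finite F \<and> F \<subseteq> \<C> \<and> disjoint F \<and> card F = k \<and> (\<forall>C\<in>F. S \<inter> C \<noteq> {}))"
proof
  assume "k \<le> card S"
  then obtain T where T: "T \<subseteq> S" "card T = k" "finite T"
    by (metis obtain_subset_with_card_n)
  obtain U where U: "\<And>x. x \<in> T \<Longrightarrow> x \<in> U x" "U ` T \<subseteq> \<C>"
    "\<And>x y. x \<in> T \<Longrightarrow> y \<in> T \<Longrightarrow> x \<noteq> y \<Longrightarrow> U x \<inter> U y = {}"
    using finite_separated_by_basis[OF T(3) basis] by metis
  have "inj_on U T"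
    by (rule inj_onI) (metis U(1,3) disjoint_iff)
  then have "card (U ` T) = k"
    using T by (simp add: card_image)
  moreover have "disjoint (U ` T)"
    using U(3) by (auto simp: disjoint_def)
  moreover have "S \<inter> C \<noteq> {}" if "C \<in> U ` T" for C
    using that U(1) T(1) by auto
  ultimately show "\<exists>F. finite F \<and> F \<subseteq> \<C> \<and> disjoint F \<and> card F = k \<and> (\<forall>C\<in>F. S \<inter> C \<noteq> {})"
    using T(3) U(2) by (intro exI[of _ "U ` T"]) auto
next
  assume "\<exists>F. finite F \<and> F \<subseteq> \<C> \<and> disjoint F \<and> card F = k \<and> (\<forall>C\<in>F. S \<inter> C \<noteq> {})"
  then obtain F where F: "finite F" "disjoint F" "card F = k" "\<forall>C\<in>F. S \<inter> C \<noteq> {}"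
    by blast
  then obtain f where f: "\<And>C. C \<in> F \<Longrightarrow> f C \<in> S \<inter> C"
    by (meson ex_in_conv)
  have "inj_on f F"
  proof (rule inj_onI)
    fix C D assume "C \<in> F" "D \<in> F" "f C = f D"
    then have "C \<inter> D \<noteq> {}" using f[of C] f[of D] by auto
    then show "C = D"
      using F(2) \<open>C \<in> F\<close> \<open>D \<in> F\<close> by (auto simp: disjoint_def)
  qed
  then have "card F \<le> card S"
    using f \<open>finite S\<close> by (intro card_inj_on_le[of f]) auto
  then show "k \<le> card S" using F by simp
qed

text \<open>
  Only void events inside \<open>B\<close> are used: this is what makes counts of disjoint sets independent.
\<close>

lemma card_eq_in_sigma_void:
  fixes B :: "'a::euclidean_space set"
  assumes B: "B \<in> bounded_borel"
  shows "{\<phi>. locally_finite \<phi> \<and> card (\<phi> \<inter> B) = k}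
    \<in> sigma_sets {\<phi>. locally_finite \<phi>} (void_event ` {C \<in> sets borel. C \<subseteq> B})"
    (is "_ \<in> sigma_sets ?\<Omega> ?G")
proof -
  obtain \<C> :: "'a set set" where \<C>: "countable \<C>" "topological_basis \<C>"
    using ex_countable_basis by blast
  interpret sigma_algebra ?\<Omega> "sigma_sets ?\<Omega> ?G"
    by (rule sigma_algebra_sigma_sets) (auto simp: void_event_def)
  define \<F> where "\<F> k = {F. finite F \<and> F \<subseteq> \<C> \<and> disjoint F \<and> card F = k}" for k
  \<comment> \<open>A countable base has only countably many finite subfamilies, so the union over
    \<open>\<F> k\<close> below is a countable one.\<close>
  have cnt: "countable (\<F> k)" for k
    by (rule countable_subset[OF _ countable_Collect_finite_subset[OF \<C>(1)]]) (auto simp: \<F>_def)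
  have ge: "{\<phi>. locally_finite \<phi> \<and> k \<le> card (\<phi> \<inter> B)} \<in> sigma_sets ?\<Omega> ?G" for k
  proof -
    have "{\<phi>. locally_finite \<phi> \<and> k \<le> card (\<phi> \<inter> B)}
        = (\<Union>F\<in>\<F> k. ?\<Omega> - (\<Union>C\<in>F. void_event (B \<inter> C)))"
    proof -
      have *: "\<phi> \<in> (\<Union>F\<in>\<F> k. ?\<Omega> - (\<Union>C\<in>F. void_event (B \<inter> C))) \<longleftrightarrow>
          locally_finite \<phi> \<and> (\<exists>F\<in>\<F> k. \<forall>C\<in>F. \<phi> \<inter> (B \<inter> C) \<noteq> {})" for \<phi>
        by (cases "locally_finite \<phi>")
          (simp_all only: mem_Collect_eq UN_iff Diff_iff void_event_def Bex_def Ball_def not_ex de_Morgan_conj not_not simp_thms ex_simps imp_conv_disj)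
      have "k \<le> card (\<phi> \<inter> B) \<longleftrightarrow> (\<exists>F\<in>\<F> k. \<forall>C\<in>F. \<phi> \<inter> (B \<inter> C) \<noteq> {})"
        if "locally_finite \<phi>" for \<phi>
        unfolding card_ge_iff_basis[OF locally_finiteD[OF that B] \<C>(2)] \<F>_def Int_assoc
        by (simp add: Bex_def conj_assoc)
      then show ?thesis
        by (intro set_eqI) (simp only: * mem_Collect_eq cong: conj_cong)
    qed
    also have "\<dots> \<in> sigma_sets ?\<Omega> ?G"
    proof (rule countable_UN'[OF cnt], rule image_subsetI)
      fix F assume F: "F \<in> \<F> k"
      have "void_event (B \<inter> C) \<in> sigma_sets ?\<Omega> ?G" if "C \<in> F" for C
      proof -
        have "open C" using that F \<C>(2) by (auto simp: \<F>_def topological_basis_open)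
        then show ?thesis using B by (intro sigma_sets.Basic) (auto simp: bounded_borel_def)
      qed
      then show "?\<Omega> - (\<Union>C\<in>F. void_event (B \<inter> C)) \<in> sigma_sets ?\<Omega> ?G"
        using F by (intro compl_sets finite_UN) (simp_all add: \<F>_def)
    qed
    finally show ?thesis .
  qed
  have "{\<phi>. locally_finite \<phi> \<and> card (\<phi> \<inter> B) = k} = {\<phi>. locally_finite \<phi> \<and> k \<le> card (\<phi> \<inter> B)} 
     - {\<phi>. locally_finite \<phi> \<and> Suc k \<le> card (\<phi> \<inter> B)}"
    by auto
  then show ?thesis
    using Diff[OF ge ge] by simp
qed

text \<open>Void events are the events of count zero, since local finiteness excludes an infinite
  intersection, for which \<open>card\<close> would also be 0. The other inclusion recovers every
  count from void events.\<close>

lemma sets_config_space_void: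
  "sets config_space = sigma_sets {\<phi>::'a::euclidean_space set. locally_finite \<phi>}
     (void_event ` bounded_borel)"
proof
  have "void_event B \<in> sets config_space" if "B \<in> bounded_borel" for B :: "'a set"
  proof -
    have "void_event B = {\<phi>. locally_finite \<phi> \<and> card (\<phi> \<inter> B) = 0}"
      using locally_finiteD[OF _ that] by (auto simp: void_event_def)
    then show ?thesis
      unfolding sets_config_space using that by (intro sigma_sets.Basic) auto
  qed
  then show "sigma_sets {\<phi>::'a set. locally_finite \<phi>} (void_event ` bounded_borel) \<subseteq> sets config_space"
    using sets.sigma_sets_subset[of "void_event ` bounded_borel" "config_space :: 'a set measure"]
    by (auto simp: space_config_space)
  have "{\<phi>. locally_finite \<phi> \<and> card (\<phi> \<inter> B) = k} \<in>
      sigma_sets {\<phi>. locally_finite \<phi>} (void_event ` bounded_borel)"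
    if "B \<in> bounded_borel" for B :: "'a set" and k
    by (rule subsetD[OF sigma_sets_mono' card_eq_in_sigma_void[OF that]])
      (use that bounded_subset in \<open>auto simp: bounded_borel_def\<close>)
  then show "sets config_space \<subseteq> sigma_sets {\<phi>::'a set. locally_finite \<phi>} (void_event ` bounded_borel)"
    unfolding sets_config_space by (intro sigma_sets_mono) auto
qed

lemma void_event_sets: "B \<in> bounded_borel \<Longrightarrow> void_event B \<in> sets config_space"
  unfolding sets_config_space_void by blast

lemma measurable_config_spaceI:
  assumes "\<And>\<omega>. \<omega> \<in> space M \<Longrightarrow> locally_finite (f \<omega>)"
    and "\<And>B. B \<in> bounded_borel \<Longrightarrow> {\<omega> \<in> space M. f \<omega> \<inter> B = {}} \<in> sets M"
  shows "f \<in> M \<rightarrow>\<^sub>M (config_space :: 'a::euclidean_space set measure)"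
proof (rule measurable_sigma_sets[OF sets_config_space_void])
  fix A assume "A \<in> void_event ` (bounded_borel :: 'a set set)"
  then obtain B :: "'a set" where B: "B \<in> bounded_borel" "A = void_event B" by blast
  have "f -` A \<inter> space M = {\<omega> \<in> space M. f \<omega> \<inter> B = {}}"
    using assms(1) B by (auto simp: void_event_def)
  then show "f -` A \<inter> space M \<in> sets M" using assms(2) B by simp
qed (use assms in \<open>auto simp: void_event_def\<close>)

lemma Int_stable_void: "Int_stable (void_event ` (bounded_borel :: 'a::euclidean_space set set))"
proof (rule Int_stableI)
  fix a b assume "a \<in> void_event ` (bounded_borel :: 'a set set)" "b \<in> void_event ` (bounded_borel :: 'a set set)"
  then obtain A B :: "'a set" where "A \<in> bounded_borel" "a = void_event A" "B \<in> bounded_borel" "b = void_event B" by blast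
  then show "a \<inter> b \<in> void_event ` bounded_borel"
    by (intro image_eqI[of _ _ "A \<union> B"]) (auto simp: void_event_Un bounded_borel_def)
qed

text \<open>Void events form a generator closed under intersection, and \<open>void_event {}\<close>
  is the whole space, so the constant sequence exhausts it and the uniqueness theorem for measures
  applies.\<close>

lemma measure_eq_if_void_eq:
  fixes M N :: "'a::euclidean_space set measure"
  assumes "prob_space M" "prob_space N" "sets M = sets config_space" "sets N = sets config_space"
    and eq: "\<And>B. B \<in> bounded_borel \<Longrightarrow> measure M (void_event B) = measure N (void_event B)"
  shows "M = N"
proof (rule measure_eqI_generator_eq[where A = "\<lambda>_. void_event {}"])
  interpret M: prob_space M by fact
  interpret N: prob_space N by fact
  show "Int_stable (void_event ` (bounded_borel :: 'a set set))" by (rule Int_stable_void)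
  show "emeasure M X = emeasure N X" if "X \<in> void_event ` bounded_borel" for X
    using that eq by (auto simp: M.emeasure_eq_measure N.emeasure_eq_measure)
  show "emeasure M (void_event {}) \<noteq> \<infinity>" by simp
  show "void_event ` bounded_borel \<subseteq> Pow {\<phi>::'a set. locally_finite \<phi>}"
    by (auto simp: void_event_def)
  show "range (\<lambda>_. void_event {}) \<subseteq> void_event ` (bounded_borel :: 'a set set)"
    by (auto simp: bounded_borel_def)
  show "(\<Union>i. void_event {}) = {\<phi>::'a set. locally_finite \<phi>}"
    by (simp add: void_event_empty)
qed (use assms in \<open>simp_all add: sets_config_space_void\<close>)

section \<open>Renyi's theorem\<close>

text \<open>By strong induction: once the lower coefficients vanish, dividing by
  \<open>s ^ k\<close> leaves a series with constant term \<open>a k\<close> that is zero on (0, 1),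
  and letting \<open>s\<close> tend to 0 isolates this term.\<close>

lemma powser_zero_coeffs:
  fixes a :: "nat \<Rightarrow> real"
  assumes "\<And>s. 0 < s \<Longrightarrow> s < 1 \<Longrightarrow> (\<lambda>k. a k * s ^ k) sums 0"
  shows "a k = 0"
proof (induction k rule: less_induct)
  case (less k)
  have sums0: "(\<lambda>n. a (n + k) * s ^ n) sums 0" if s: "0 < s" "s < 1" for s :: real
  proof -
    have "(\<lambda>n. a (n + k) * s ^ (n + k)) sums (0 - (\<Sum>i<k. a i * s ^ i))"
      by (rule sums_split_initial_segment[OF assms[OF s]])
    also have "(\<Sum>i<k. a i * s ^ i) = 0"
      using less by (intro sum.neutral) auto
    finally have "(\<lambda>n. (a (n + k) * s ^ (n + k)) / s ^ k) sums (0 / s ^ k)"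
      by (intro sums_divide) simp
    then show ?thesis
      using s by (simp add: power_add)
  qed
  define f where "f x = (\<Sum>n. a (n + k) * x ^ n)" for x :: real
  have "(\<lambda>n. a (n + k) * x ^ n) sums f x" if "norm x < 1 / 2" for x
    unfolding f_def
    by (intro summable_sums powser_inside[OF sums_summable[OF sums0[of "1/2"]]]) (use that in auto)
  then have "(f \<longlongrightarrow> a (0 + k)) (at 0)"
    by (intro powser_limit_0[of "1/2"]) auto
  \<comment> \<open>The hypothesis covers positive \<open>s\<close> only, so the limit is restricted
    to the right-hand side before it is compared with 0.\<close>
  then have "(f \<longlongrightarrow> a k) (at_right 0)"
    by (rule filterlim_mono) (auto simp: at_le)
  moreover have "eventually (\<lambda>x. f x = 0) (at_right 0)"
    unfolding f_def using eventually_at_right_real[of 0 "1 :: real"]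
    by (auto elim!: eventually_mono simp: sums0[THEN sums_unique, symmetric])
  then have "(f \<longlongrightarrow> 0) (at_right 0)"
    by (rule tendsto_eventually)
  ultimately show ?case
    using tendsto_unique trivial_limit_at_right_real by blast
qed

text \<open>The product of the quadratic Taylor polynomials at \<open>v\<close> and at
  \<open>- v\<close> is \<open>1 + (v\<^sup>2 / 2)\<^sup>2\<close>, hence at least 1, and the first
  of them is a lower bound for \<open>exp v\<close>.\<close>

lemma exp_minus_le_quadratic:
  fixes v :: real
  assumes "v \<ge> 0"
  shows "exp (- v) \<le> 1 - v + v\<^sup>2 / 2"
proof -
  have "1 \<le> 1 + (v\<^sup>2 / 2)\<^sup>2" by simp
  also have "\<dots> = (1 + v + v\<^sup>2 / 2) * (1 - v + v\<^sup>2 / 2)"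
    by (simp add: field_simps power2_eq_square)
  also have "\<dots> \<le> exp v * (1 - v + v\<^sup>2 / 2)"
  proof (intro mult_right_mono exp_lower_Taylor_quadratic assms)
    have "1 - v + v\<^sup>2 / 2 = ((1 - v)\<^sup>2 + 1) / 2"
      by (simp add: field_simps power2_eq_square)
    also have "0 \<le> \<dots>" by simp
    finally show "0 \<le> 1 - v + v\<^sup>2 / 2" .
  qed
  finally show ?thesis
    by (simp add: exp_minus field_simps)
qed

text \<open>The first term is the generating function at \<open>s\<close> of the indicator that a
  cell of mean \<open>v\<close> is hit, which has probability \<open>1 - exp (- v)\<close>; the
  second is that of a Poisson variable of mean \<open>v\<close>. The error is quadratic, so its sum
  over a fine partition vanishes in the limit.\<close>

lemma bernoulli_poisson_approx:
  fixes s v :: real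
  assumes "0 \<le> s" "s \<le> 1" "0 \<le> v"
  shows "\<bar>(s + (1 - s) * exp (- v)) - exp (- ((1 - s) * v))\<bar> \<le> v\<^sup>2"
proof -
  let ?w = "(1 - s) * v"
  have w: "0 \<le> ?w" "?w \<le> v"
    using assms by (auto intro: mult_left_le_one_le)
  have 1: "1 - v \<le> exp (- v)" "1 - ?w \<le> exp (- ?w)"
    using exp_ge_add_one_self[of "- v"] exp_ge_add_one_self[of "- ?w"] by auto
  have "?w\<^sup>2 \<le> v\<^sup>2"
    using w by (intro power_mono) auto
  then have 2: "exp (- ?w) \<le> 1 - ?w + v\<^sup>2 / 2"
    using exp_minus_le_quadratic[OF w(1)] by simp
  have "(1 - s) * (1 - v) \<le> (1 - s) * exp (- v)"
    "(1 - s) * exp (- v) \<le> (1 - s) * (1 - v + v\<^sup>2 / 2)"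
    using assms 1 exp_minus_le_quadratic[of v] by (auto intro!: mult_left_mono)
  moreover have "(1 - s) * (v\<^sup>2 / 2) \<le> v\<^sup>2 / 2"
    using assms by (intro mult_left_le_one_le) auto
  moreover have "(1 - s) * (1 - v) = 1 - s - ?w"
    "(1 - s) * (1 - v + v\<^sup>2 / 2) = 1 - s - ?w + (1 - s) * (v\<^sup>2 / 2)"
    by (simp_all add: algebra_simps)
  ultimately show ?thesis
    using 1 2 zero_le_power2[of v] unfolding abs_le_iff by linarith
qed

section \<open>Partition of space into small cubes\<close>

text \<open>
  The fibres of \<open>grid m\<close> are the cubes of side \<open>1 / m\<close>; for \<open>m = 0\<close> there is a single fibre.
\<close>

definition grid :: "nat \<Rightarrow> 'a::euclidean_space \<Rightarrow> 'a" where
  "grid m x = (\<Sum>b\<in>Basis. of_int \<lfloor>real m * (x \<bullet> b)\<rfloor> *\<^sub>R b)"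

lemma grid_inner: "b \<in> Basis \<Longrightarrow> grid m x \<bullet> b = of_int \<lfloor>real m * (x \<bullet> b)\<rfloor>"
  by (simp add: grid_def inner_sum_left_Basis)

lemma grid_measurable [measurable]: "grid m \<in> borel_measurable borel"
  unfolding grid_def by measurable

lemma finite_grid_image:
  assumes "bounded B"
  shows "finite (grid m ` B)"
proof -
  obtain R where R: "\<And>x. x \<in> B \<Longrightarrow> norm x \<le> R"
    using assms by (auto simp: bounded_iff)
  define K where "K = \<lceil>real m * R\<rceil> + 1"
  have "grid m x \<in> (\<lambda>f. \<Sum>b\<in>Basis. of_int (f b) *\<^sub>R b) ` (Basis \<rightarrow>\<^sub>E {- K..K})"
    if "x \<in> B" for x :: 'a
  proof (rule image_eqI)
    show "grid m x = (\<Sum>b\<in>Basis. of_int (restrict (\<lambda>b. \<lfloor>real m * (x \<bullet> b)\<rfloor>) Basis b) *\<^sub>R b)"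
      by (simp add: grid_def)
    have "\<lfloor>real m * (x \<bullet> b)\<rfloor> \<in> {- K..K}" if b: "b \<in> Basis" for b
    proof -
      have "\<bar>x \<bullet> b\<bar> \<le> R"
        using Basis_le_norm[OF b, of x] R[OF \<open>x \<in> B\<close>] by simp
      then have "\<bar>real m * (x \<bullet> b)\<bar> \<le> real m * R"
        by (simp add: abs_mult mult_left_mono)
      then show ?thesis
        unfolding K_def by (simp add: abs_le_iff) linarith
    qed
    then show "restrict (\<lambda>b. \<lfloor>real m * (x \<bullet> b)\<rfloor>) Basis \<in> Basis \<rightarrow>\<^sub>E {- K..K}"
      by auto
  qed
  then have "grid m ` B \<subseteq> (\<lambda>f. \<Sum>b\<in>Basis. of_int (f b) *\<^sub>R b) ` (Basis \<rightarrow>\<^sub>E {- K..K})"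
    by blast
  then show ?thesis
    by (rule finite_subset) (auto intro!: finite_imageI finite_PiE)
qed

text \<open>A cell lies in a cube of side \<open>1 / m\<close>. Its volume is bounded crudely by the
  side length, which is enough because the cell volumes only have to tend to 0 uniformly.\<close>

lemma measure_grid_cell_le:
  assumes "m > 0"
  shows "measure lborel (B \<inter> grid m -` {c :: 'a::euclidean_space}) \<le> 1 / real m"
proof (cases "B \<inter> grid m -` {c} \<in> sets lborel")
  case True
  have "B \<inter> grid m -` {c} \<subseteq> cbox (c /\<^sub>R real m) ((c + One) /\<^sub>R real m)"
  proof
    fix x assume x: "x \<in> B \<inter> grid m -` {c}"
    show "x \<in> cbox (c /\<^sub>R real m) ((c + One) /\<^sub>R real m)"
      unfolding mem_box
    proof (intro ballI)
      fix b :: 'a assume b: "b \<in> Basis"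
      have "c \<bullet> b = of_int \<lfloor>real m * (x \<bullet> b)\<rfloor>"
        using x grid_inner[OF b, of m x] by auto
      then have "c \<bullet> b \<le> real m * (x \<bullet> b)" "real m * (x \<bullet> b) \<le> c \<bullet> b + 1"
        by linarith+
      then show "(c /\<^sub>R real m) \<bullet> b \<le> x \<bullet> b \<and> x \<bullet> b \<le> ((c + One) /\<^sub>R real m) \<bullet> b"
        using b assms by (simp add: inner_add_left field_simps)
    qed
  qed
  then have "measure lborel (B \<inter> grid m -` {c}) \<le> measure lborel (cbox (c /\<^sub>R real m) ((c + One) /\<^sub>R real m))"
    using True by (intro measure_mono_fmeasurable) auto
  also have "\<dots> = (\<Prod>b\<in>(Basis::'a set). 1 / real m)"
    using assms by (subst measure_lborel_cbox_eq) (auto simp: inner_add_left field_simps intro!: prod.cong)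
  also have "\<dots> = (1 / real m) ^ DIM('a)"
    by simp
  \<comment> \<open>The dimension is at least 1 and \<open>1 / m\<close> is at most 1.\<close>
  also have "\<dots> \<le> (1 / real m) ^ 1"
    using assms by (intro power_decreasing) (auto simp: Suc_le_eq)
  finally show ?thesis by simp
qed (simp add: measure_notin_sets)

text \<open>Distinct points differ in some coordinate; once \<open>m\<close> times that difference
  is at least 1 the two floors differ, and finitely many pairs allow a common threshold.\<close>

lemma eventually_inj_on_grid:
  assumes "finite F"
  shows "\<forall>\<^sub>F m in sequentially. inj_on (grid m) F"
proof -
  have pair: "\<forall>\<^sub>F m in sequentially. x \<noteq> y \<longrightarrow> grid m x \<noteq> grid m y" for x y :: 'a
  proof (cases "x = y")
    case False
    then obtain b where b: "b \<in> Basis" "x \<bullet> b \<noteq> y \<bullet> b"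
      by (auto simp: euclidean_eq_iff[of x y])
    show ?thesis
    proof (rule eventually_sequentiallyI)
      fix m assume m: "nat \<lceil>1 / \<bar>x \<bullet> b - y \<bullet> b\<bar>\<rceil> \<le> m"
      then have "1 / \<bar>x \<bullet> b - y \<bullet> b\<bar> \<le> real m"
        by linarith
      then have "1 \<le> \<bar>real m * (x \<bullet> b) - real m * (y \<bullet> b)\<bar>"
      proof -
        have "1 \<le> real m * \<bar>x \<bullet> b - y \<bullet> b\<bar>"
          using \<open>1 / _ \<le> _\<close> b by (simp add: pos_divide_le_eq)
        also have "\<dots> = \<bar>real m * (x \<bullet> b) - real m * (y \<bullet> b)\<bar>"
          by (simp add: abs_mult flip: right_diff_distrib)
        finally show ?thesis .
      qed
      then have "\<lfloor>real m * (x \<bullet> b)\<rfloor> \<noteq> \<lfloor>real m * (y \<bullet> b)\<rfloor>"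
        by linarith
      then show "x \<noteq> y \<longrightarrow> grid m x \<noteq> grid m y"
        using grid_inner[OF b(1)] by (metis of_int_eq_iff)
    qed
  qed simp
  have "\<forall>\<^sub>F m in sequentially. \<forall>x\<in>F. \<forall>y\<in>F. x \<noteq> y \<longrightarrow> grid m x \<noteq> grid m y"
    using assms pair by (intro eventually_ball_finite ballI) auto
  then show ?thesis
    by eventually_elim (auto intro!: inj_onI)
qed

section \<open>Counts under a law with exponential void probabilities\<close>

locale void_poisson = prob_space N
  for N :: "'a::euclidean_space set measure" +
  fixes lam :: real
  assumes lam_nonneg: "lam \<ge> 0"
    and sets_eq: "sets N = sets config_space"
    and void_prob: "\<And>B. B \<in> bounded_borel \<Longrightarrow>
      measure N (void_event B) = exp (- (lam * measure lborel B))"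
begin

lemma space_eq: "space N = {\<phi>. locally_finite \<phi>}"
  using sets_eq_imp_space_eq[OF sets_eq] by (simp add: space_config_space)

lemma void_event_measurable [measurable]: "B \<in> bounded_borel \<Longrightarrow> void_event B \<in> events"
  by (simp add: sets_eq void_event_sets)

text \<open>The exponential turns additivity of volume into a product. All independence below comes
  from this.\<close>

lemma void_prob_UN:
  assumes "finite I" "\<And>i. i \<in> I \<Longrightarrow> C i \<in> bounded_borel" "disjoint_family_on C I"
  shows "prob (void_event (\<Union>i\<in>I. C i)) = (\<Prod>i\<in>I. prob (void_event (C i)))"
proof -
  have "(\<Union>i\<in>I. C i) \<in> bounded_borel"
    using assms by (auto simp: bounded_borel_def)
  moreover have "measure lborel (\<Union>i\<in>I. C i) = (\<Sum>i\<in>I. measure lborel (C i))"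
  proof (rule measure_finite_Union)
    show "emeasure lborel (C i) \<noteq> \<infinity>" if "i \<in> I" for i
      using emeasure_bounded_finite[of "C i"] assms(2)[OF that] by (auto simp: bounded_borel_def)
  qed (use assms in \<open>auto simp: bounded_borel_def\<close>)
  ultimately show ?thesis
    using assms by (simp add: void_prob sum_distrib_left sum_negf[symmetric] exp_sum)
qed

text \<open>For each \<open>B\<close> the void events of Borel subsets of \<open>B\<close> are
  closed under intersection, and they are independent for disjoint sets. Independence therefore
  extends to the generated sigma-algebras, which contain the events of the counts.\<close>

lemma indep_counts:
  assumes sub: "\<B> \<subseteq> bounded_borel" and disj: "disjoint \<B>"
  shows "indep_vars (\<lambda>_. count_space UNIV) (\<lambda>B \<phi>. card (\<phi> \<inter> B)) \<B>"
proof -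
  define G where "G B = void_event ` {C \<in> sets borel. C \<subseteq> B}" for B :: "'a set"
  have bb: "C \<in> bounded_borel" if "C \<in> sets borel" "C \<subseteq> B" "B \<in> \<B>" for C B
    using that sub bounded_subset by (auto simp: bounded_borel_def)
  have "indep_sets G \<B>"
  proof (rule indep_setsI)
    show "G B \<subseteq> events" if "B \<in> \<B>" for B
      using bb[OF _ _ that] by (auto simp: G_def)
  next
    fix A J assume J: "J \<noteq> {}" "J \<subseteq> \<B>" "finite J" and A: "\<forall>B\<in>J. A B \<in> G B"
    have "\<forall>B\<in>J. \<exists>C. C \<in> sets borel \<and> C \<subseteq> B \<and> A B = void_event C"
      using A by (auto simp: G_def)
    then obtain C where C: "\<And>B. B \<in> J \<Longrightarrow> C B \<in> sets borel"
      "\<And>B. B \<in> J \<Longrightarrow> C B \<subseteq> B" "\<And>B. B \<in> J \<Longrightarrow> A B = void_event (C B)"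
      by metis
    have "disjoint_family_on C J"
      unfolding disjoint_family_on_def
    proof (intro ballI impI)
      fix B D assume BD: "B \<in> J" "D \<in> J" "B \<noteq> D"
      then have "B \<inter> D = {}"
        using J(2) disj by (auto dest: disjointD)
      then show "C B \<inter> C D = {}"
        using C(2)[of B] C(2)[of D] BD by blast
    qed
    moreover have "(\<Inter>B\<in>J. A B) = void_event (\<Union>B\<in>J. C B)"
      using J(1) C(3) by (simp add: void_event_UN)
    ultimately show "prob (\<Inter>B\<in>J. A B) = (\<Prod>B\<in>J. prob (A B))"
    proof -
      have "C B \<in> bounded_borel" if "B \<in> J" for B
        using bb C(1,2)[OF that] J(2) that by blast
      then have "prob (void_event (\<Union>B\<in>J. C B)) = (\<Prod>B\<in>J. prob (void_event (C B)))"
        using \<open>disjoint_family_on C J\<close> by (rule void_prob_UN[OF J(3)])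
      then show ?thesis
        using \<open>(\<Inter>B\<in>J. A B) = _\<close> C(3) by simp
    qed
  qed
  moreover have "Int_stable (G B)" for B
  proof (rule Int_stableI)
    fix a b assume "a \<in> G B" "b \<in> G B"
    then obtain A A' where "A \<in> sets borel" "A \<subseteq> B" "a = void_event A"
      "A' \<in> sets borel" "A' \<subseteq> B" "b = void_event A'"
      by (auto simp: G_def)
    then show "a \<inter> b \<in> G B"
      unfolding G_def by (intro image_eqI[of _ _ "A \<union> A'"]) (auto simp: void_event_Un)
  qed
  ultimately have indep: "indep_sets (\<lambda>B. sigma_sets (space N) (G B)) \<B>"
    by (intro indep_sets_sigma) auto
  have gen: "(\<lambda>\<phi>. card (\<phi> \<inter> B)) -` A \<inter> space N \<in> sigma_sets (space N) (G B)"
    if B: "B \<in> \<B>" for A B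
  proof -
    interpret S: sigma_algebra "space N" "sigma_sets (space N) (G B)"
      by (rule sigma_algebra_sigma_sets) (auto simp: G_def space_eq void_event_def)
    have "(\<lambda>\<phi>. card (\<phi> \<inter> B)) -` A \<inter> space N = (\<Union>k\<in>A. {\<phi>. locally_finite \<phi> \<and> card (\<phi> \<inter> B) = k})"
      by (auto simp: space_eq)
    also have "\<dots> \<in> sigma_sets (space N) (G B)"
      using card_eq_in_sigma_void[of B] B sub
      by (intro S.countable_UN'') (auto simp: space_eq G_def)
    finally show ?thesis .
  qed
  have "sigma_sets (space N) (G B) \<subseteq> events" if "B \<in> \<B>" for B
    using bb[OF _ _ that] by (intro sets.sigma_sets_subset) (auto simp: G_def)
  then have "random_variable (count_space UNIV) (\<lambda>\<phi>. card (\<phi> \<inter> B))" if "B \<in> \<B>" for B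
    using gen[OF that] that by (intro measurableI) auto
  then show ?thesis
    unfolding indep_vars_def2
    by (intro conjI ballI indep_sets_mono_sets[OF indep]) (use gen in auto)
qed

text \<open>This is the generating function at \<open>s\<close> of the number of sets
  \<open>C i\<close> that are hit. Each factor is \<open>(1 - s)\<close> times a void indicator plus
  \<open>s\<close>; expanding over subsets leaves void probabilities of unions, which factor, and
  the expansion is folded back.\<close>

lemma expectation_prod_void:
  assumes "finite I" "\<And>i. i \<in> I \<Longrightarrow> C i \<in> bounded_borel" "disjoint_family_on C I"
  shows "expectation (\<lambda>\<phi>. \<Prod>i\<in>I. if \<phi> \<inter> C i = {} then 1 else s)
    = (\<Prod>i\<in>I. s + (1 - s) * exp (- (lam * measure lborel (C i))))"
proof -
  have meas: "(\<Union>i\<in>S. C i) \<in> bounded_borel" if "S \<subseteq> I" for S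
    using that assms(1,2) finite_subset[OF that assms(1)] by (auto simp: bounded_borel_def)
  let ?c = "\<lambda>S. (1 - s) ^ card S * s ^ card (I - S)"
  have "expectation (\<lambda>\<phi>. \<Prod>i\<in>I. if \<phi> \<inter> C i = {} then 1 else s)
      = expectation (\<lambda>\<phi>. \<Sum>S\<in>Pow I. ?c S * indicator (void_event (\<Union>i\<in>S. C i)) \<phi>)"
  proof (rule Bochner_Integration.integral_cong[OF refl])
    fix \<phi> assume "\<phi> \<in> space N"
    then have lf: "locally_finite \<phi>" by (simp add: space_eq)
    have "(\<Prod>i\<in>I. if \<phi> \<inter> C i = {} then 1 else s)
        = (\<Prod>i\<in>I. (1 - s) * indicator (void_event (C i)) \<phi> + s)"
      using lf by (intro prod.cong) (auto simp: void_event_def)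
    also have "\<dots> = (\<Sum>S\<in>Pow I. (\<Prod>i\<in>S. (1 - s) * indicator (void_event (C i)) \<phi>) * (\<Prod>i\<in>I - S. s))"
      by (rule prod_add[OF assms(1)])
    also have "\<dots> = (\<Sum>S\<in>Pow I. ?c S * indicator (void_event (\<Union>i\<in>S. C i)) \<phi>)"
    proof (rule sum.cong[OF refl])
      fix S assume "S \<in> Pow I"
      then have "finite S" using assms(1) finite_subset by blast
      then have "(\<Prod>i\<in>S. indicator (void_event (C i)) \<phi> :: real) = indicator (void_event (\<Union>i\<in>S. C i)) \<phi>"
        by induction (auto simp: void_event_Un void_event_empty lf indicator_inter_arith)
      then show "(\<Prod>i\<in>S. (1 - s) * indicator (void_event (C i)) \<phi>) * (\<Prod>i\<in>I - S. s)
          = ?c S * indicator (void_event (\<Union>i\<in>S. C i)) \<phi>"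
        by (simp add: prod.distrib)
    qed
    finally show "(\<Prod>i\<in>I. if \<phi> \<inter> C i = {} then 1 else s)
      = (\<Sum>S\<in>Pow I. ?c S * indicator (void_event (\<Union>i\<in>S. C i)) \<phi>)" .
  qed
  also have "\<dots> = (\<Sum>S\<in>Pow I. ?c S * prob (void_event (\<Union>i\<in>S. C i)))"
    using meas by (subst Bochner_Integration.integral_sum) (auto simp: less_top[symmetric])
  also have "\<dots> = (\<Sum>S\<in>Pow I. (\<Prod>i\<in>S. (1 - s) * prob (void_event (C i))) * (\<Prod>i\<in>I - S. s))"
  proof (rule sum.cong[OF refl])
    fix S assume S: "S \<in> Pow I"
    have "prob (void_event (\<Union>i\<in>S. C i)) = (\<Prod>i\<in>S. prob (void_event (C i)))"
      using S assms finite_subset[of S I]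
      by (intro void_prob_UN) (auto intro: disjoint_family_on_mono[of S I])
    then show "?c S * prob (void_event (\<Union>i\<in>S. C i))
        = (\<Prod>i\<in>S. (1 - s) * prob (void_event (C i))) * (\<Prod>i\<in>I - S. s)"
      by (simp add: prod.distrib)
  qed
  also have "\<dots> = (\<Prod>i\<in>I. (1 - s) * prob (void_event (C i)) + s)"
    by (rule prod_add[OF assms(1), symmetric])
  also have "\<dots> = (\<Prod>i\<in>I. s + (1 - s) * exp (- (lam * measure lborel (C i))))"
    using assms(2) by (intro prod.cong) (auto simp: void_prob)
  finally show ?thesis .
qed

lemma count_measurable:
  assumes "B \<in> bounded_borel"
  shows "(\<lambda>\<phi>. card (\<phi> \<inter> B)) \<in> N \<rightarrow>\<^sub>M count_space UNIV"
  using indep_counts[of "{B}"] assms by (simp add: indep_vars_def)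

text \<open>
  The number of grid cells hit by \<open>\<phi> \<inter> B\<close> is a sum of independent Bernoulli variables and
  eventually equals \<open>card (\<phi> \<inter> B)\<close>, since a fine grid separates finitely many points.
\<close>

lemma pgf_count:
  assumes B: "B \<in> bounded_borel" and s: "0 < s" "s < 1"
  shows "expectation (\<lambda>\<phi>. s ^ card (\<phi> \<inter> B)) = exp (- ((1 - s) * (lam * measure lborel B)))"
proof -
  define C where "C m c = B \<inter> grid m -` {c}" for m c
  define Y where "Y m \<phi> = (\<Prod>c\<in>grid m ` B. if \<phi> \<inter> C m c = {} then 1 else s)" for m \<phi>
  have fin: "finite (grid m ` B)" for m
    using B by (intro finite_grid_image) (auto simp: bounded_borel_def)
  have C: "C m c \<in> bounded_borel" for m c
    using B bounded_subset[of B "C m c"] measurable_sets[OF grid_measurable, of "{c}" m]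
    by (auto simp: bounded_borel_def C_def)
  have disj: "disjoint_family_on (C m) (grid m ` B)" for m
    by (auto simp: disjoint_family_on_def C_def)
  have Ymeas: "Y m \<in> borel_measurable N" for m
  proof -
    have "(\<lambda>\<phi>. if \<phi> \<inter> C m c = {} then 1 else s) \<in> borel_measurable N" for c
    proof (rule measurable_cong[THEN iffD1])
      show "(\<lambda>\<phi>. if \<phi> \<in> void_event (C m c) then 1 else s) \<in> borel_measurable N"
        using C by measurable
    qed (auto simp: space_eq void_event_def)
    then show ?thesis
      unfolding Y_def by (intro borel_measurable_prod) auto
  qed
  have Ylim: "(\<lambda>m. Y m \<phi>) \<longlonglongrightarrow> s ^ card (\<phi> \<inter> B)" if "locally_finite \<phi>" for \<phi>
  proof (rule tendsto_eventually)
    have "\<forall>\<^sub>F m in sequentially. inj_on (grid m) (\<phi> \<inter> B)"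
      using locally_finiteD[OF that B] by (rule eventually_inj_on_grid)
    then show "\<forall>\<^sub>F m in sequentially. Y m \<phi> = s ^ card (\<phi> \<inter> B)"
    proof eventually_elim
      case (elim m)
      have "Y m \<phi> = (\<Prod>c\<in>grid m ` B. if c \<in> grid m ` (\<phi> \<inter> B) then s else 1)"
      proof -
        have "\<phi> \<inter> C m c = {} \<longleftrightarrow> c \<notin> grid m ` (\<phi> \<inter> B)" for c
          by (auto simp: C_def)
        then show ?thesis
          unfolding Y_def by (intro prod.cong) auto
      qed
      also have "\<dots> = (\<Prod>c\<in>grid m ` B \<inter> grid m ` (\<phi> \<inter> B). s)"
        by (rule prod.inter_restrict[OF fin, symmetric])
      also have "grid m ` B \<inter> grid m ` (\<phi> \<inter> B) = grid m ` (\<phi> \<inter> B)"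
        by auto
      finally show ?case
        using elim by (simp add: card_image)
    qed
  qed
  have "(\<lambda>m. expectation (Y m)) \<longlonglongrightarrow> expectation (\<lambda>\<phi>. s ^ card (\<phi> \<inter> B))"
  proof (rule integral_dominated_convergence[where w = "\<lambda>_. 1"])
    show "(\<lambda>\<phi>. s ^ card (\<phi> \<inter> B)) \<in> borel_measurable N"
      using measurable_compose[OF count_measurable[OF B], of "\<lambda>k. s ^ k" borel] by simp
    show "AE \<phi> in N. norm (Y m \<phi>) \<le> 1" for m
      using s by (intro AE_I2) (auto simp: Y_def abs_prod intro!: prod_le_1)
    show "AE \<phi> in N. (\<lambda>m. Y m \<phi>) \<longlonglongrightarrow> s ^ card (\<phi> \<inter> B)"
      using Ylim by (intro AE_I2) (auto simp: space_eq)
  qed (use Ymeas in auto)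
  moreover have "(\<lambda>m. expectation (Y m)) \<longlonglongrightarrow> exp (- ((1 - s) * (lam * measure lborel B)))"
  proof (rule Lim_transform_bound[THEN LIM_zero_cancel])
    let ?v = "\<lambda>m c. lam * measure lborel (C m c)"
    let ?V = "lam * measure lborel B"
    have V: "(\<Sum>c\<in>grid m ` B. ?v m c) = ?V" for m
    proof -
      have "B = (\<Union>c\<in>grid m ` B. C m c)"
        by (auto simp: C_def)
      also have "measure lborel \<dots> = (\<Sum>c\<in>grid m ` B. measure lborel (C m c))"
        using C[of m] disj[of m] fin[of m] emeasure_bounded_finite[of "C m _"]
        by (intro measure_finite_Union) (auto simp: bounded_borel_def less_top[symmetric])
      finally show ?thesis by (simp add: sum_distrib_left)
    qed
    show "\<forall>\<^sub>F m in sequentially. norm (expectation (Y m) - exp (- ((1 - s) * ?V)))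
        \<le> norm (?V * (lam / real m))"
    proof (rule eventually_sequentiallyI)
      fix m :: nat assume m: "1 \<le> m"
      have "expectation (Y m) = (\<Prod>c\<in>grid m ` B. s + (1 - s) * exp (- ?v m c))"
        unfolding Y_def by (rule expectation_prod_void[OF fin C disj])
      moreover have "exp (- ((1 - s) * ?V)) = (\<Prod>c\<in>grid m ` B. exp (- ((1 - s) * ?v m c)))"
      proof -
        have "(\<Sum>c\<in>grid m ` B. - ((1 - s) * ?v m c)) = - ((1 - s) * (\<Sum>c\<in>grid m ` B. ?v m c))"
          by (simp add: sum_negf flip: sum_distrib_left)
        then show ?thesis
          unfolding V using exp_sum[OF fin[of m], of "\<lambda>c. - ((1 - s) * ?v m c)"] by simp
      qed
      ultimately have "norm (expectation (Y m) - exp (- ((1 - s) * ?V)))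
          = norm ((\<Prod>c\<in>grid m ` B. s + (1 - s) * exp (- ?v m c)) - (\<Prod>c\<in>grid m ` B. exp (- ((1 - s) * ?v m c))))"
        by simp
      also have "\<dots> \<le> (\<Sum>c\<in>grid m ` B. norm ((s + (1 - s) * exp (- ?v m c)) - exp (- ((1 - s) * ?v m c))))"
      \<comment> \<open>All factors have absolute value at most 1, so exchanging them one at a time
        bounds the difference of the products by the sum of the differences.\<close>
      proof (rule norm_prod_diff)
        fix c
        have "(1 - s) * exp (- ?v m c) \<le> 1 - s"
          using s lam_nonneg by (intro mult_right_le_one_le) auto
        moreover have "0 \<le> (1 - s) * exp (- ?v m c)"
          using s by simp
        moreover have "norm (s + t) \<le> 1" if "t \<le> 1 - s" "0 \<le> t" for t
          using s that by simp
        ultimately show "norm (s + (1 - s) * exp (- ?v m c)) \<le> 1"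
          by blast
        show "norm (exp (- ((1 - s) * ?v m c))) \<le> 1"
          using s lam_nonneg by simp
      qed
      also have "\<dots> \<le> (\<Sum>c\<in>grid m ` B. ?v m c * (lam / real m))"
      proof (rule sum_mono)
        fix c
        have "norm ((s + (1 - s) * exp (- ?v m c)) - exp (- ((1 - s) * ?v m c))) \<le> (?v m c)\<^sup>2"
          unfolding real_norm_def using s lam_nonneg by (intro bernoulli_poisson_approx) auto
        \<comment> \<open>One factor of the square is bounded by the largest cell volume; the other
          is kept and sums to the total mean \<open>?V\<close>.\<close>
        also have "\<dots> \<le> ?v m c * (lam / real m)"
        proof -
          have "?v m c \<le> lam * (1 / real m)"
            unfolding C_def using m lam_nonneg by (intro mult_left_mono measure_grid_cell_le) auto
          then have "?v m c * ?v m c \<le> ?v m c * (lam / real m)"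
            using lam_nonneg by (intro mult_left_mono) auto
          then show ?thesis
            by (simp only: power2_eq_square)
        qed
        finally show "norm ((s + (1 - s) * exp (- ?v m c)) - exp (- ((1 - s) * ?v m c))) \<le> ?v m c * (lam / real m)" .
      qed
      also have "\<dots> = ?V * (lam / real m)"
        by (simp only: V flip: sum_distrib_right)
      also have "\<dots> \<le> norm \<dots>"
        unfolding real_norm_def by (rule abs_ge_self)
      finally show "norm (expectation (Y m) - exp (- ((1 - s) * ?V))) \<le> norm (?V * (lam / real m))" .
    qed
    show "(\<lambda>m. ?V * (lam / real m)) \<longlonglongrightarrow> 0"
      by (intro tendsto_mult_right_zero lim_const_over_n)
  qed
  ultimately show ?thesis
    by (rule LIMSEQ_unique)
qed

text \<open>The generating function on (0, 1) determines the distribution: the differences between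
  the actual and the Poisson weights are the coefficients of a power series that vanishes
  there.\<close>

lemma prob_count:
  assumes B: "B \<in> bounded_borel"
  shows "prob {\<phi> \<in> space N. card (\<phi> \<inter> B) = k} =
    (lam * measure lborel B) ^ k / fact k * exp (- (lam * measure lborel B))"
proof -
  define E where "E k = {\<phi> \<in> space N. card (\<phi> \<inter> B) = k}" for k
  define V where "V = lam * measure lborel B"
  have E [measurable]: "E k \<in> events" for k
    unfolding E_def using measurable_sets[OF count_measurable[OF B], of "{k}"]
    by (simp add: vimage_def Int_def conj_commute)
  have "(\<lambda>k. (prob (E k) - V ^ k / fact k * exp (- V)) * s ^ k) sums 0" if s: "0 < s" "s < 1" for s
  proof -
    have single: "(\<lambda>k. s ^ k * indicator (E k) \<phi>) sums s ^ card (\<phi> \<inter> B)" if "\<phi> \<in> space N" for \<phi>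
    proof -
      have "(\<lambda>k. s ^ k * indicator (E k) \<phi>) = (\<lambda>k. if k = card (\<phi> \<inter> B) then s ^ k else 0)"
        using that by (auto simp: E_def indicator_def)
      then show ?thesis
        using sums_single[of "card (\<phi> \<inter> B)" "\<lambda>k. s ^ k"] by simp
    qed
    have "(\<lambda>k. expectation (\<lambda>\<phi>. s ^ k * indicator (E k) \<phi>)) sums
        expectation (\<lambda>\<phi>. \<Sum>k. s ^ k * indicator (E k) \<phi>)"
    proof (rule sums_integral)
      show "integrable N (\<lambda>\<phi>. s ^ k * indicator (E k) \<phi>)" for k
        by (intro integrable_mult_right) (auto simp: less_top[symmetric])
      show "AE \<phi> in N. summable (\<lambda>k. norm (s ^ k * indicator (E k) \<phi>))"
        using s single by (intro AE_I2) (auto simp: abs_mult dest: sums_summable)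
      have "summable (\<lambda>k. s ^ k * prob (E k))"
        by (rule summable_comparison_test[OF _ summable_geometric[of s]])
          (use s in \<open>auto intro!: exI[of _ 0] mult_left_le\<close>)
      then show "summable (\<lambda>k. expectation (\<lambda>\<phi>. norm (s ^ k * indicator (E k) \<phi>)))"
        using s by (simp add: abs_mult)
    qed
    moreover have "expectation (\<lambda>\<phi>. \<Sum>k. s ^ k * indicator (E k) \<phi>) = expectation (\<lambda>\<phi>. s ^ card (\<phi> \<inter> B))"
      by (intro Bochner_Integration.integral_cong) (auto simp: sums_unique[OF single, symmetric])
    ultimately have "(\<lambda>k. s ^ k * prob (E k)) sums exp (- ((1 - s) * V))"
      using pgf_count[OF B s] by (simp add: V_def)
    moreover have "(\<lambda>k. exp (- V) * ((s * V) ^ k /\<^sub>R fact k)) sums (exp (- V) * exp (s * V))"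
      by (intro sums_mult exp_converges)
    then have "(\<lambda>k. (V ^ k / fact k * exp (- V)) * s ^ k) sums exp (- ((1 - s) * V))"
      by (simp add: exp_add[symmetric] power_mult_distrib field_simps)
    ultimately have "(\<lambda>k. s ^ k * prob (E k) - (V ^ k / fact k * exp (- V)) * s ^ k)
       sums (exp (- ((1 - s) * V)) - exp (- ((1 - s) * V)))"
      by (rule sums_diff)
    then show ?thesis
      by (simp add: algebra_simps)
  qed
  from powser_zero_coeffs[OF this, of k] show ?thesis
    by (simp add: E_def V_def)
qed

text \<open>Renyi's theorem: void probabilities alone yield the Poisson counts and their
  independence.\<close>

lemma poisson_process_id: "poisson_process N lam (\<lambda>\<phi>. \<phi>)"
  unfolding poisson_process_def
  using prob_count indep_counts prob_space_axioms measurable_ident_sets[OF sets_eq]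
  by (auto simp: id_def)

end

section \<open>Existence, uniqueness and superposition\<close>

text \<open>If each of a Poisson number of independent points avoids a set with probability
  \<open>q\<close>, this is the probability that all of them do.\<close>

lemma nn_integral_poisson_power:
  assumes "rate > 0" "0 \<le> q"
  shows "(\<integral>\<^sup>+k. ennreal (q ^ k) \<partial>measure_pmf (poisson_pmf rate)) = ennreal (exp (- (rate * (1 - q))))"
proof -
  have "(\<lambda>k. exp (- rate) * ((q * rate) ^ k /\<^sub>R fact k)) sums (exp (- rate) * exp (q * rate))"
    by (intro sums_mult exp_converges)
  then have sums: "(\<lambda>k. rate ^ k / fact k * exp (- rate) * q ^ k) sums exp (- (rate * (1 - q)))"
    by (simp add: exp_add[symmetric] power_mult_distrib field_simps)
  have "(\<integral>\<^sup>+k. ennreal (q ^ k) \<partial>measure_pmf (poisson_pmf rate))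
      = (\<Sum>k. ennreal (rate ^ k / fact k * exp (- rate) * q ^ k))"
    unfolding nn_integral_measure_pmf nn_integral_count_space_nat
    using assms by (intro suminf_cong) (simp add: ennreal_mult[symmetric])
  also have "\<dots> = ennreal (exp (- (rate * (1 - q))))"
    using assms by (intro suminf_ennreal_eq[OF _ sums]) auto
  finally show ?thesis .
qed

text \<open>A Poisson number of independent uniform points; if \<open>A\<close> is a null set there is no uniform
  distribution on it, and the empty configuration does the job.\<close>

lemma poisson_process_on_bounded_set:
  fixes A :: "'a::euclidean_space set"
  assumes "lam > 0" and A: "A \<in> bounded_borel"
  shows "\<exists>N. prob_space N \<and> sets N = sets config_space \<and>
    (\<forall>B\<in>bounded_borel. measure N (void_event B) = exp (- (lam * measure lborel (A \<inter> B))))"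
proof (cases "measure lborel A = 0")
  case True
  \<comment> \<open>Here \<open>B\<close> is arbitrary; a non-measurable intersection has measure 0
    by convention.\<close>
  have "measure lborel (A \<inter> B) = 0" for B
  proof (cases "A \<inter> B \<in> sets lborel")
    case False
    then show ?thesis by (rule measure_notin_sets)
  next
    case True
    have "emeasure lborel A < \<infinity>"
      using A emeasure_bounded_finite[of A] by (simp add: bounded_borel_def)
    then have "measure lborel (A \<inter> B) \<le> measure lborel A"
      using A True by (intro measure_mono_fmeasurable) (auto simp: fmeasurable_def bounded_borel_def)
    then show ?thesis
      using \<open>measure lborel A = 0\<close> by (simp add: measure_le_0_iff)
  qed
  moreover have "measure (return config_space {}) (void_event B) = 1" if "B \<in> bounded_borel" for B :: "'a set"
    using measure_return[OF void_event_sets[OF that], of "{}"]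
    by (simp add: void_event_def locally_finite_empty)
  ultimately show ?thesis
    by (intro exI[of _ "return config_space {}"])
      (auto simp: space_config_space locally_finite_empty intro!: prob_space_return)
next
  case False
  define U where "U = uniform_measure lborel A"
  have A_fin: "emeasure lborel A = ennreal (measure lborel A)" "A \<in> sets borel"
    using A emeasure_bounded_finite[of A]
    by (auto simp: bounded_borel_def less_top[symmetric] intro!: emeasure_eq_ennreal_measure)
  have "measure lborel A > 0"
    using False by (simp add: zero_less_measure_iff)
  interpret U: prob_space U
    unfolding U_def using A_fin \<open>measure lborel A > 0\<close> by (intro prob_space_uniform_measure) auto
  have sets_U: "sets U = sets borel" and space_U: "space U = UNIV"
    by (auto simp: U_def)
  interpret PU: product_prob_space "\<lambda>_::nat. U" UNIV
    by (intro product_prob_spaceI) unfold_locales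
  define rate where "rate = lam * measure lborel A"
  have "rate > 0"
    using \<open>measure lborel A > 0\<close> \<open>lam > 0\<close> by (simp add: rate_def)
  define K where "K = measure_pmf (poisson_pmf rate)"
  interpret K: prob_space K
    unfolding K_def by (rule prob_space_measure_pmf)
  define P where "P = K \<Otimes>\<^sub>M PiM UNIV (\<lambda>_::nat. U)"
  interpret KP: pair_prob_space K "PiM UNIV (\<lambda>_::nat. U)" ..
  interpret P: prob_space P
    unfolding P_def by (rule prob_space_pair) unfold_locales
  \<comment> \<open>A sample is a number \<open>k\<close> and an infinite sequence of positions, of
    which the first \<open>k\<close> are used; number and positions are thus independent. Coinciding
    positions merge in the image, which no void event detects.\<close>
  define f where "f = (\<lambda>(k :: nat, u :: nat \<Rightarrow> 'a). u ` {..<k})"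
  have sets_K: "sets K = sets (count_space UNIV)" and space_K: "space K = UNIV"
    by (auto simp: K_def)
  have void_eq: "{\<omega> \<in> space P. f \<omega> \<inter> B = {}} = {\<omega> \<in> space P. \<forall>i. i < fst \<omega> \<longrightarrow> snd \<omega> i \<notin> B}" for B
    by (auto simp: f_def disjoint_iff)
  have void_sets: "{\<omega> \<in> space P. f \<omega> \<inter> B = {}} \<in> sets P" if "B \<in> bounded_borel" for B
  proof -
    have [measurable]: "B \<in> sets U"
      using that by (simp add: sets_U bounded_borel_def)
    have [measurable]: "fst \<in> P \<rightarrow>\<^sub>M count_space UNIV"
      unfolding P_def
      by (subst measurable_cong_sets[OF refl sets_K[symmetric]]) (rule measurable_fst)
    have [measurable]: "(\<lambda>\<omega>. snd \<omega> i) \<in> P \<rightarrow>\<^sub>M U" for i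
      unfolding P_def by measurable
    show ?thesis
      unfolding void_eq by measurable
  qed
  have f: "f \<in> P \<rightarrow>\<^sub>M config_space"
    by (rule measurable_config_spaceI[OF _ void_sets]) (auto simp: f_def locally_finite_finite)
  have "measure (distr P config_space f) (void_event B) = exp (- (lam * measure lborel (A \<inter> B)))"
    if B: "B \<in> bounded_borel" for B
  proof -
    let ?E = "{\<omega> \<in> space P. f \<omega> \<inter> B = {}}"
    define p where "p = measure lborel (A \<inter> B) / measure lborel A"
    have B_borel: "B \<in> sets borel"
      using B by (simp add: bounded_borel_def)
    have "measure U B = p"
      using A_fin B_borel \<open>measure lborel A > 0\<close> by (simp add: U_def p_def measure_uniform_measure)
    then have U_B: "emeasure U (- B) = ennreal (1 - p)" "0 \<le> 1 - p"
      using U.prob_compl[of B] U.prob_le_1[of B] B_borel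
      by (auto simp: U.emeasure_eq_measure sets_U space_U Compl_eq_Diff_UNIV)
    have "emeasure P ?E = (\<integral>\<^sup>+k. emeasure (PiM UNIV (\<lambda>_. U)) (Pair k -` ?E) \<partial>K)"
      using void_sets[OF B] unfolding P_def by (rule PU.P.emeasure_pair_measure_alt)
    also have "\<dots> = (\<integral>\<^sup>+k. ennreal ((1 - p) ^ k) \<partial>K)"
    proof (rule nn_integral_cong)
      fix k
      have "Pair k -` ?E = {u \<in> space (PiM UNIV (\<lambda>_. U)). \<forall>i\<in>{..<k}. u i \<in> - B}"
        by (auto simp: P_def f_def space_pair_measure space_K)
      also have "emeasure (PiM UNIV (\<lambda>_. U)) \<dots> = (\<Prod>i<k. emeasure U (- B))"
        using B_borel by (intro PU.emeasure_PiM_Collect) (auto simp: sets_U)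
      also have "\<dots> = ennreal ((1 - p) ^ k)"
        using U_B by (simp add: ennreal_power)
      finally show "emeasure (PiM UNIV (\<lambda>_. U)) (Pair k -` ?E) = ennreal ((1 - p) ^ k)" .
    qed
    also have "\<dots> = ennreal (exp (- (rate * (1 - (1 - p)))))"
      unfolding K_def by (rule nn_integral_poisson_power[OF \<open>rate > 0\<close> U_B(2)])
    also have "rate * (1 - (1 - p)) = lam * measure lborel (A \<inter> B)"
      using False by (simp add: rate_def p_def)
    finally have "measure P ?E = exp (- (lam * measure lborel (A \<inter> B)))"
      by (simp add: measure_def)
    moreover have "f -` void_event B \<inter> space P = ?E"
      by (auto simp: f_def void_event_def locally_finite_finite)
    ultimately show ?thesis
      using f B by (simp add: measure_distr void_event_sets)
  qed
  then show ?thesis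
    using P.prob_space_distr[OF f] by (intro exI[of _ "distr P config_space f"]) simp
qed

text \<open>Independent pieces are glued along disjoint shells. A bounded set meets only finitely
  many shells, so its void probability is a finite product whose exponents add up to its
  volume.\<close>

lemma void_poisson_exists:
  assumes "lam > 0"
  shows "\<exists>N :: 'a::euclidean_space set measure. void_poisson N lam"
proof -
  define A :: "nat \<Rightarrow> 'a set" where "A n = {x. real n \<le> norm x \<and> norm x < real n + 1}" for n
  have A: "A n \<in> bounded_borel" for n
  proof -
    have "bounded (A n)"
      by (rule bounded_subset[OF bounded_cball[of 0 "real n + 1"]]) (auto simp: A_def)
    moreover have "A n \<in> sets borel"
      unfolding A_def by measurable
    ultimately show ?thesis by (simp add: bounded_borel_def)
  qed
  have A_disj: "disjoint_family A"
    by (auto simp: A_def disjoint_family_on_def)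
  have cover: "\<exists>m. B \<subseteq> (\<Union>n<m. A n)" if bounded: "bounded B" for B :: "'a set"
  proof -
    obtain R where R: "\<And>x. x \<in> B \<Longrightarrow> norm x \<le> R"
      using bounded by (auto simp: bounded_iff)
    have "x \<in> (\<Union>n<nat \<lfloor>R\<rfloor> + 1. A n)" if "x \<in> B" for x
    proof (rule UN_I[of "nat \<lfloor>norm x\<rfloor>"])
      show "nat \<lfloor>norm x\<rfloor> \<in> {..<nat \<lfloor>R\<rfloor> + 1}"
        using R[OF that] floor_mono[of "norm x" R] by auto
      show "x \<in> A (nat \<lfloor>norm x\<rfloor>)"
        unfolding A_def by simp
    qed
    then show ?thesis by blast
  qed
  obtain N where N: "\<And>n. prob_space (N n)" "\<And>n. sets (N n) = sets (config_space :: 'a set measure)"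
    and N_void: "\<And>n B. B \<in> bounded_borel \<Longrightarrow>
      measure (N n) (void_event B) = exp (- (lam * measure lborel (A n \<inter> B)))"
    using poisson_process_on_bounded_set[OF assms A] by metis
  have space_N: "space (N n) = {\<phi>. locally_finite \<phi>}" for n
    using sets_eq_imp_space_eq[OF N(2)] by (simp add: space_config_space)
  interpret PN: product_prob_space N UNIV
    by (intro product_prob_spaceI N)
  let ?P = "PiM UNIV N"
  \<comment> \<open>Avoiding the complement of \<open>A n\<close> is not known surely under
    \<open>N n\<close>. Cutting each piece to its shell makes the union locally finite at every
    sample point.\<close>
  define f where "f \<omega> = (\<Union>n. \<omega> n \<inter> A n)" for \<omega> :: "nat \<Rightarrow> 'a set"
  have lf: "locally_finite (f \<omega>)" if \<omega>: "\<omega> \<in> space ?P" for \<omega>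
    unfolding locally_finite_def
  proof (intro allI impI)
    fix B :: "'a set" assume B: "bounded B"
    then obtain m where m: "B \<subseteq> (\<Union>n<m. A n)"
      using cover by blast
    have "f \<omega> \<inter> B \<subseteq> (\<Union>n<m. \<omega> n \<inter> B)"
    proof
      fix x assume "x \<in> f \<omega> \<inter> B"
      then obtain n k where "x \<in> B" "x \<in> \<omega> n" "x \<in> A n" "k < m" "x \<in> A k"
        using m by (auto simp: f_def)
      moreover from this have "n = k"
        using A_disj by (auto simp: disjoint_family_on_def)
      ultimately show "x \<in> (\<Union>n<m. \<omega> n \<inter> B)" by auto
    qed
    moreover have "finite (\<omega> n \<inter> B)" for n
    proof -
      have "\<omega> n \<in> space (N n)"
        using \<omega> by (auto simp: space_PiM)
      then show ?thesis
        using B by (simp add: space_N locally_finite_def)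
    qed
    ultimately show "finite (f \<omega> \<inter> B)"
      by (meson finite_UN_I finite_lessThan finite_subset)
  qed
  have void_eq: "\<exists>m. B \<subseteq> (\<Union>n<m. A n) \<and> {\<omega> \<in> space ?P. f \<omega> \<inter> B = {}} =
      {\<omega> \<in> space ?P. \<forall>n\<in>{..<m}. \<omega> n \<in> void_event (A n \<inter> B)}" if B: "B \<in> bounded_borel" for B
  proof -
    obtain m where m: "B \<subseteq> (\<Union>n<m. A n)"
      using cover[of B] B by (auto simp: bounded_borel_def)
    have "f \<omega> \<inter> B = {} \<longleftrightarrow> (\<forall>n\<in>{..<m}. \<omega> n \<in> void_event (A n \<inter> B))" if "\<omega> \<in> space ?P" for \<omega>
    proof -
      have "locally_finite (\<omega> n)" for n
        using that space_N[of n] by (auto simp: space_PiM PiE_iff)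
      moreover have "f \<omega> \<inter> B = {} \<longleftrightarrow> (\<forall>n\<in>{..<m}. \<omega> n \<inter> (A n \<inter> B) = {})"
      proof
        assume *: "\<forall>n\<in>{..<m}. \<omega> n \<inter> (A n \<inter> B) = {}"
        have False if x: "x \<in> \<omega> n" "x \<in> A n" "x \<in> B" for x n
        proof -
          obtain k where "k < m" "x \<in> A k"
            using m x(3) by blast
          moreover from this have "n = k"
            using A_disj x by (auto simp: disjoint_family_on_def)
          ultimately show False
            using * x by auto
        qed
        then show "f \<omega> \<inter> B = {}"
          by (auto simp: f_def)
      qed (auto simp: f_def)
      ultimately show ?thesis
        by (simp add: void_event_def)
    qed
    then show ?thesis
      using m by blast
  qed
  have AB: "A n \<inter> B \<in> bounded_borel" if "B \<in> bounded_borel" for n B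
    using that A[of n] by (auto simp: bounded_borel_def intro: bounded_subset)
  have void_in: "void_event (A n \<inter> B) \<in> sets (N n)" if "B \<in> bounded_borel" for n B
    using AB[OF that] by (simp add: N(2) void_event_sets)
  have f: "f \<in> ?P \<rightarrow>\<^sub>M config_space"
  proof (rule measurable_config_spaceI[OF lf])
    fix B :: "'a set" assume B: "B \<in> bounded_borel"
    obtain m where m: "{\<omega> \<in> space ?P. f \<omega> \<inter> B = {}} =
        {\<omega> \<in> space ?P. \<forall>n\<in>{..<m}. \<omega> n \<in> void_event (A n \<inter> B)}"
      using void_eq[OF B] by blast
    have "Measurable.pred ?P (\<lambda>\<omega>. \<omega> n \<in> void_event (A n \<inter> B))" for n
      using void_in[OF B] by measurable
    then show "{\<omega> \<in> space ?P. f \<omega> \<inter> B = {}} \<in> sets ?P"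
      unfolding m by measurable
  qed
  have "measure (distr ?P config_space f) (void_event B) = exp (- (lam * measure lborel B))"
    if B: "B \<in> bounded_borel" for B
  proof -
    obtain m where m: "B \<subseteq> (\<Union>n<m. A n)" "{\<omega> \<in> space ?P. f \<omega> \<inter> B = {}} =
        {\<omega> \<in> space ?P. \<forall>n\<in>{..<m}. \<omega> n \<in> void_event (A n \<inter> B)}"
      using void_eq[OF B] by blast
    have "f -` void_event B \<inter> space ?P = {\<omega> \<in> space ?P. f \<omega> \<inter> B = {}}"
      using lf by (auto simp: void_event_def)
    then have "measure (distr ?P config_space f) (void_event B)
        = measure ?P {\<omega> \<in> space ?P. \<forall>n\<in>{..<m}. \<omega> n \<in> void_event (A n \<inter> B)}"
      using f B m(2) by (simp add: measure_distr void_event_sets)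
    also have "\<dots> = (\<Prod>n<m. measure (N n) (void_event (A n \<inter> B)))"
      using PN.emeasure_PiM_Collect[of "{..<m}" "\<lambda>n. void_event (A n \<inter> B)"] void_in[OF B]
      by (simp add: PN.P.emeasure_eq_measure PN.M.emeasure_eq_measure prod_ennreal prod_nonneg)
    also have "\<dots> = (\<Prod>n<m. exp (- (lam * measure lborel (A n \<inter> B))))"
      using AB[OF B] by (simp add: N_void)
    also have "\<dots> = exp (- (lam * (\<Sum>n<m. measure lborel (A n \<inter> B))))"
      by (simp add: exp_sum sum_distrib_left sum_negf[symmetric])
    also have "(\<Sum>n<m. measure lborel (A n \<inter> B)) = measure lborel (\<Union>n<m. A n \<inter> B)"
    proof (rule measure_finite_Union[symmetric])
      show "disjoint_family_on (\<lambda>n. A n \<inter> B) {..<m}"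
        using A_disj by (auto simp: disjoint_family_on_def)
      show "emeasure lborel (A n \<inter> B) \<noteq> \<infinity>" for n
        using AB[OF B, of n] emeasure_bounded_finite[of "A n \<inter> B"] by (auto simp: bounded_borel_def)
    qed (use AB[OF B] in \<open>auto simp: bounded_borel_def\<close>)
    also have "(\<Union>n<m. A n \<inter> B) = B"
      using m(1) by blast
    finally show ?thesis .
  qed
  then have "void_poisson (distr ?P config_space f) lam"
    using PN.P.prob_space_distr[OF f] assms
    by (simp add: void_poisson_def void_poisson_axioms_def)
  then show ?thesis by blast
qed

section \<open>Identification of the Poisson law and superposition\<close>

lemma void_poissonI:
  fixes N :: "'a::euclidean_space set measure"
  assumes "sets N = sets config_space" "poisson_process N lam (\<lambda>\<phi>. \<phi>)" "lam \<ge> 0"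
  shows "void_poisson N lam"
proof -
  have space: "space N = {\<phi>. locally_finite \<phi>}"
    using sets_eq_imp_space_eq[OF assms(1)] by (simp add: space_config_space)
  interpret prob_space N
    using assms(2) by (simp add: poisson_process_def)
  show ?thesis
  proof
    fix B :: "'a set" assume B: "B \<in> bounded_borel"
    then have "void_event B = {\<phi> \<in> space N. card (\<phi> \<inter> B) = 0}"
      using locally_finiteD[OF _ B] by (auto simp: void_event_def space)
    then show "measure N (void_event B) = exp (- (lam * measure lborel B))"
      using assms(2) B by (simp add: poisson_process_def del: card_eq_0_iff)
  qed (use assms in auto)
qed

lemma void_poisson_unique: "void_poisson M lam \<Longrightarrow> void_poisson N lam \<Longrightarrow> M = N"
  unfolding void_poisson_def void_poisson_axioms_def by (intro measure_eq_if_void_eq) auto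

text \<open>Justifies the definite description in \<open>poisson_law\<close>: Renyi's theorem shows
  that \<open>N\<close> satisfies it, and any competitor has the same void probabilities.\<close>

lemma poisson_law_eq:
  assumes "void_poisson N lam"
  shows "poisson_law lam = N"
  unfolding poisson_law_def
proof (rule the_equality)
  show "sets N = sets config_space \<and> poisson_process N lam (\<lambda>\<phi>. \<phi>)"
    using assms void_poisson.sets_eq void_poisson.poisson_process_id by blast
  show "M = N" if "sets M = sets config_space \<and> poisson_process M lam (\<lambda>\<phi>. \<phi>)" for M
    using that assms void_poissonI[of M lam] void_poisson.lam_nonneg void_poisson_unique by blast
qed

lemma void_poisson_law: "lam > 0 \<Longrightarrow> void_poisson (poisson_law lam) lam"
  using void_poisson_exists poisson_law_eq by metis

text \<open>A union avoids \<open>B\<close> exactly when both parts do, so a void event pulls back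
  to a rectangle and the two void probabilities multiply.\<close>

lemma poisson_superposition:
  fixes lam mu :: real
  assumes "lam > 0" "mu > 0"
  defines "P \<equiv> poisson_law lam \<Otimes>\<^sub>M (poisson_law mu :: 'a::euclidean_space set measure)"
  shows "(\<lambda>(\<phi>, \<psi>). \<phi> \<union> \<psi>) \<in> P \<rightarrow>\<^sub>M config_space"
    and "distr P config_space (\<lambda>(\<phi>, \<psi>). \<phi> \<union> \<psi>) = poisson_law (lam + mu)"
proof -
  interpret L: void_poisson "poisson_law lam :: 'a set measure" lam
    using assms(1) by (rule void_poisson_law)
  interpret M: void_poisson "poisson_law mu :: 'a set measure" mu
    using assms(2) by (rule void_poisson_law)
  interpret LM: pair_prob_space "poisson_law lam :: 'a set measure" "poisson_law mu :: 'a set measure" ..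
  have space: "space P = {\<phi>. locally_finite \<phi>} \<times> {\<psi>. locally_finite \<psi>}"
    by (simp add: P_def space_pair_measure L.space_eq M.space_eq)
  have void: "{\<omega> \<in> space P. (case \<omega> of (\<phi>, \<psi>) \<Rightarrow> \<phi> \<union> \<psi>) \<inter> B = {}} = void_event B \<times> void_event B" for B
    by (auto simp: space void_event_def)
  show union: "(\<lambda>(\<phi>, \<psi>). \<phi> \<union> \<psi>) \<in> P \<rightarrow>\<^sub>M config_space"
  proof (rule measurable_config_spaceI)
    fix B :: "'a set" assume "B \<in> bounded_borel"
    then show "{\<omega> \<in> space P. (case \<omega> of (\<phi>, \<psi>) \<Rightarrow> \<phi> \<union> \<psi>) \<inter> B = {}} \<in> sets P"
      unfolding void unfolding P_def by (intro pair_measureI L.void_event_measurable M.void_event_measurable)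
  qed (auto simp: space locally_finite_Un)
  have "measure (distr P config_space (\<lambda>(\<phi>, \<psi>). \<phi> \<union> \<psi>)) (void_event B)
      = exp (- ((lam + mu) * measure lborel B))" if B: "B \<in> bounded_borel" for B
  proof -
    have "(\<lambda>(\<phi>, \<psi>). \<phi> \<union> \<psi>) -` void_event B \<inter> space P = void_event B \<times> void_event B"
      by (auto simp: space void_event_def locally_finite_Un)
    then have "measure (distr P config_space (\<lambda>(\<phi>, \<psi>). \<phi> \<union> \<psi>)) (void_event B)
        = measure P (void_event B \<times> void_event B)"
      using union B by (simp add: measure_distr void_event_sets)
    also have "\<dots> = L.prob (void_event B) * M.prob (void_event B)"
      unfolding P_def using B by (simp add: measure_def M.emeasure_pair_measure_Times enn2real_mult)
    also have "\<dots> = exp (- ((lam + mu) * measure lborel B))"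
      using B by (simp add: L.void_prob M.void_prob algebra_simps flip: exp_add)
    finally show ?thesis .
  qed
  then have "void_poisson (distr P config_space (\<lambda>(\<phi>, \<psi>). \<phi> \<union> \<psi>)) (lam + mu)"
    using LM.prob_space_distr[of "\<lambda>(\<phi>, \<psi>). \<phi> \<union> \<psi>"] union assms
    by (simp add: void_poisson_def void_poisson_axioms_def)
  from poisson_law_eq[OF this] show "distr P config_space (\<lambda>(\<phi>, \<psi>). \<phi> \<union> \<psi>) = poisson_law (lam + mu)"
    by simp
qed

section \<open>Percolation\<close>

text \<open>Replaces a percolation event by a measurable null cover, so that measurability of
  percolation never has to be shown.\<close>

lemma outer_measure_of_eq_0_iff:
  assumes "A \<subseteq> space M"
  shows "outer_measure_of M A = 0 \<longleftrightarrow> (\<exists>E\<in>null_sets M. A \<subseteq> E)"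
proof
  assume "outer_measure_of M A = 0"
  then show "\<exists>E\<in>null_sets M. A \<subseteq> E"
    using outer_measure_of_attain[OF assms] by (auto simp: null_sets_def)
next
  assume "\<exists>E\<in>null_sets M. A \<subseteq> E"
  then obtain E where "E \<in> null_sets M" "A \<subseteq> E" by blast
  then show "outer_measure_of M A = 0"
    using outer_measure_of_mono[of A E M] by (auto simp: null_sets_def)
qed

section \<open>Deterministic comparison of the graphs\<close>

text \<open>The closure \<open>E'\<^sup>*\<close> in the hypothesis lets an edge be replaced by a
  path, as the detour through a witness requires.\<close>

lemma percolates_mono:
  assumes "percolates V E" "V \<subseteq> V'" "E \<subseteq> E'\<^sup>*"
  shows "percolates V' E'"
proof -
  obtain x where x: "x \<in> V" "infinite (E\<^sup>* `` {x})"
    using assms(1) by (auto simp: percolates_def)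
  have "E\<^sup>* `` {x} \<subseteq> E'\<^sup>* `` {x}"
    using rtrancl_subset_rtrancl[OF assms(3)] by blast
  then have "infinite (E'\<^sup>* `` {x})"
    using x(2) finite_subset by blast
  then show ?thesis
    using x(1) assms(2) by (auto simp: percolates_def)
qed

lemma boolean_edges_mono: "\<phi> \<subseteq> \<psi> \<Longrightarrow> boolean_edges \<phi> \<rho> \<subseteq> boolean_edges \<psi> \<rho>"
  by (auto simp: boolean_edges_def)

lemma ab_edges_subset_boolean: "ab_edges \<phi> \<psi> r \<subseteq> boolean_edges \<phi> (2 * r)"
proof -
  have "dist x y \<le> 2 * (2 * r)" if "dist x z \<le> 2 * r" "dist y z \<le> 2 * r" for x y z :: 'a
    using dist_triangle2[of x y z] that by simp
  then show ?thesis
    unfolding ab_edges_def boolean_edges_def by blast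
qed

lemma ab_edges_subset_rtrancl_boolean: "ab_edges \<phi> \<psi> r \<subseteq> (boolean_edges (\<phi> \<union> \<psi>) r)\<^sup>*"
proof clarify
  fix x y assume "(x, y) \<in> ab_edges \<phi> \<psi> r"
  then obtain z where z: "x \<in> \<phi>" "y \<in> \<phi>" "z \<in> \<psi>" "dist x z \<le> 2 * r" "dist z y \<le> 2 * r"
    by (auto simp: ab_edges_def dist_commute)
  \<comment> \<open>A witness may coincide with an endpoint, where the continuum graph has no loop;
    reflexivity of the closure covers this case.\<close>
  have step: "(u, v) \<in> (boolean_edges (\<phi> \<union> \<psi>) r)\<^sup>*"
    if "u \<in> \<phi> \<union> \<psi>" "v \<in> \<phi> \<union> \<psi>" "dist u v \<le> 2 * r" for u v
    using that by (cases "u = v") (auto simp: boolean_edges_def)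
  have "(x, z) \<in> (boolean_edges (\<phi> \<union> \<psi>) r)\<^sup>*" "(z, y) \<in> (boolean_edges (\<phi> \<union> \<psi>) r)\<^sup>*"
    using z by (auto intro!: step)
  then show "(x, y) \<in> (boolean_edges (\<phi> \<union> \<psi>) r)\<^sup>*"
    by (rule rtrancl_trans)
qed

section \<open>Null percolation events\<close>

lemma superposition_null_set:
  fixes lam mu \<rho> :: real
  assumes "lam > 0" "mu > 0" and null: "boolean_perc_prob TYPE('a::euclidean_space) (lam + mu) \<rho> = 0"
  obtains Z where "Z \<in> null_sets (poisson_law lam \<Otimes>\<^sub>M (poisson_law mu :: 'a set measure))"
    "\<And>\<phi> \<psi>. locally_finite \<phi> \<Longrightarrow> locally_finite \<psi> \<Longrightarrow>
      percolates (\<phi> \<union> \<psi>) (boolean_edges (\<phi> \<union> \<psi>) \<rho>) \<Longrightarrow> (\<phi>, \<psi>) \<in> Z"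
proof -
  let ?P = "poisson_law lam \<Otimes>\<^sub>M (poisson_law mu :: 'a set measure)"
  let ?u = "\<lambda>(\<phi> :: 'a set, \<psi>). \<phi> \<union> \<psi>"
  interpret L: void_poisson "poisson_law lam :: 'a set measure" lam
    using assms(1) by (rule void_poisson_law)
  interpret M: void_poisson "poisson_law mu :: 'a set measure" mu
    using assms(2) by (rule void_poisson_law)
  interpret LM: void_poisson "poisson_law (lam + mu) :: 'a set measure" "lam + mu"
    using assms(1,2) by (intro void_poisson_law) simp
  obtain E :: "'a set set" where E: "E \<in> null_sets (poisson_law (lam + mu))"
    "{\<phi>. locally_finite \<phi> \<and> percolates \<phi> (boolean_edges \<phi> \<rho>)} \<subseteq> E"
    using null unfolding boolean_perc_prob_def
    by (subst (asm) outer_measure_of_eq_0_iff) (auto simp: LM.space_eq)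
  \<comment> \<open>The law of intensity \<open>lam + mu\<close> is the image of the product law
    under union, so the null cover pulls back to a null set of pairs.\<close>
  have "E \<in> null_sets (distr ?P config_space ?u)"
    using E(1) poisson_superposition(2)[OF assms(1,2), where 'a = 'a] by simp
  then have "?u -` E \<inter> space ?P \<in> null_sets ?P"
    by (simp add: null_sets_distr_iff poisson_superposition(1)[OF assms(1,2)])
  then show thesis
  proof (rule that)
    fix \<phi> \<psi> :: "'a set"
    assume *: "locally_finite \<phi>" "locally_finite \<psi>" "percolates (\<phi> \<union> \<psi>) (boolean_edges (\<phi> \<union> \<psi>) \<rho>)"
    then have "\<phi> \<union> \<psi> \<in> E"
      using E(2) locally_finite_Un by blast
    then show "(\<phi>, \<psi>) \<in> ?u -` E \<inter> space ?P"
      using * by (simp add: space_pair_measure L.space_eq M.space_eq)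
  qed
qed

lemma boolean_perc_prob_null_mono:
  assumes "0 < lam" "lam < lam'" and null: "boolean_perc_prob TYPE('a::euclidean_space) lam' \<rho> = 0"
  shows "boolean_perc_prob TYPE('a) lam \<rho> = 0"
proof -
  define mu where "mu = lam' - lam"
  have mu: "mu > 0" "lam' = lam + mu"
    using assms by (auto simp: mu_def)
  interpret L: void_poisson "poisson_law lam :: 'a set measure" lam
    using assms(1) by (rule void_poisson_law)
  interpret M: void_poisson "poisson_law mu :: 'a set measure" mu
    using mu(1) by (rule void_poisson_law)
  \<comment> \<open>The added process is the first factor, so that Fubini allows its configuration
    to be fixed while the process of intensity \<open>lam\<close> stays random.\<close>
  interpret pair_prob_space "poisson_law mu :: 'a set measure" "poisson_law lam :: 'a set measure" ..
  obtain Z where Z: "Z \<in> null_sets (poisson_law mu \<Otimes>\<^sub>M (poisson_law lam :: 'a set measure))"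
    "\<And>\<phi> \<psi>. locally_finite \<phi> \<Longrightarrow> locally_finite \<psi> \<Longrightarrow>
      percolates (\<phi> \<union> \<psi>) (boolean_edges (\<phi> \<union> \<psi>) \<rho>) \<Longrightarrow> (\<phi>, \<psi>) \<in> Z"
    using superposition_null_set[OF mu(1) assms(1), where 'a = 'a] null mu(2) by (metis add.commute)
  have "AE \<omega> in poisson_law mu \<Otimes>\<^sub>M poisson_law lam. \<omega> \<notin> Z"
    using Z(1) by (rule AE_not_in)
  then have AE: "AE \<xi> in poisson_law mu. AE \<phi> in poisson_law lam. (\<xi>, \<phi>) \<notin> Z"
    by (rule AE_pair)
  \<comment> \<open>A property that holds almost surely under a probability measure holds at some
    point; one such configuration \<open>\<xi>\<close> suffices.\<close>
  have "\<exists>\<xi>\<in>space (poisson_law mu). AE \<phi> in poisson_law lam. (\<xi>, \<phi>) \<notin> Z"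
  proof (rule ccontr)
    assume "\<not> ?thesis"
    then show False
      by (intro M.AE_contr[OF AE] AE_I2) blast
  qed
  then obtain \<xi> :: "'a set" where \<xi>: "locally_finite \<xi>" "AE \<phi> in poisson_law lam. (\<xi>, \<phi>) \<notin> Z"
    by (auto simp: M.space_eq)
  obtain E where E: "\<And>\<phi>. \<phi> \<in> space (poisson_law lam) - E \<Longrightarrow> (\<xi>, \<phi>) \<notin> Z" "E \<in> null_sets (poisson_law lam)"
    using AE_E3[OF \<xi>(2)] by blast
  have "\<phi> \<in> E" if "locally_finite \<phi>" "percolates \<phi> (boolean_edges \<phi> \<rho>)" for \<phi>
  proof -
    have "boolean_edges \<phi> \<rho> \<subseteq> (boolean_edges (\<xi> \<union> \<phi>) \<rho>)\<^sup>*"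
      using boolean_edges_mono[of \<phi> "\<xi> \<union> \<phi>" \<rho>] by auto
    then have "percolates (\<xi> \<union> \<phi>) (boolean_edges (\<xi> \<union> \<phi>) \<rho>)"
      by (rule percolates_mono[OF that(2) Un_upper2])
    then show ?thesis
      using Z(2)[OF \<xi>(1) that(1)] E(1)[of \<phi>] that(1) by (auto simp: L.space_eq)
  qed
  then show ?thesis
    unfolding boolean_perc_prob_def using E(2)
    by (subst outer_measure_of_eq_0_iff) (auto simp: L.space_eq)
qed

lemma ab_perc_prob_null_superposition:
  assumes "lam > 0" "mu > 0" "boolean_perc_prob TYPE('a::euclidean_space) (lam + mu) r = 0"
  shows "ab_perc_prob TYPE('a) lam mu r = 0"
proof -
  interpret L: void_poisson "poisson_law lam :: 'a set measure" lam
    using assms(1) by (rule void_poisson_law)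
  interpret M: void_poisson "poisson_law mu :: 'a set measure" mu
    using assms(2) by (rule void_poisson_law)
  obtain Z where Z: "Z \<in> null_sets (poisson_law lam \<Otimes>\<^sub>M (poisson_law mu :: 'a set measure))"
    "\<And>\<phi> \<psi>. locally_finite \<phi> \<Longrightarrow> locally_finite \<psi> \<Longrightarrow>
      percolates (\<phi> \<union> \<psi>) (boolean_edges (\<phi> \<union> \<psi>) r) \<Longrightarrow> (\<phi>, \<psi>) \<in> Z"
    using superposition_null_set[OF assms] by metis
  have "(\<phi>, \<psi>) \<in> Z"
    if "locally_finite \<phi>" "locally_finite \<psi>" "percolates \<phi> (ab_edges \<phi> \<psi> r)" for \<phi> \<psi>
    using that percolates_mono[OF that(3) Un_upper1 ab_edges_subset_rtrancl_boolean] by (intro Z(2))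
  then show ?thesis
    unfolding ab_perc_prob_def using Z(1)
    by (subst outer_measure_of_eq_0_iff)
      (auto simp: space_pair_measure L.space_eq M.space_eq intro!: bexI[of _ Z])
qed

text \<open>The edge inclusion holds for every second configuration, so the exceptional set is a
  cylinder over a null set of the first process, for any value of \<open>mu\<close>.\<close>

lemma ab_perc_prob_null_boolean:
  assumes "lam > 0" "mu > 0" "boolean_perc_prob TYPE('a::euclidean_space) lam (2 * r) = 0"
  shows "ab_perc_prob TYPE('a) lam mu r = 0"
proof -
  interpret L: void_poisson "poisson_law lam :: 'a set measure" lam
    using assms(1) by (rule void_poisson_law)
  interpret M: void_poisson "poisson_law mu :: 'a set measure" mu
    using assms(2) by (rule void_poisson_law)
  obtain E :: "'a set set" where E: "E \<in> null_sets (poisson_law lam)"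
    "{\<phi>. locally_finite \<phi> \<and> percolates \<phi> (boolean_edges \<phi> (2 * r))} \<subseteq> E"
    using assms(3) unfolding boolean_perc_prob_def
    by (subst (asm) outer_measure_of_eq_0_iff) (auto simp: L.space_eq)
  let ?Z = "E \<times> space (poisson_law mu :: 'a set measure)"
  have Z: "?Z \<in> null_sets (poisson_law lam \<Otimes>\<^sub>M poisson_law mu)"
    using E(1) by (auto simp: null_sets_def M.emeasure_pair_measure_Times)
  have "(\<phi>, \<psi>) \<in> ?Z"
    if "locally_finite \<phi>" "locally_finite \<psi>" "percolates \<phi> (ab_edges \<phi> \<psi> r)" for \<phi> \<psi>
  proof -
    have "ab_edges \<phi> \<psi> r \<subseteq> (boolean_edges \<phi> (2 * r))\<^sup>*"
      using ab_edges_subset_boolean[of \<phi> \<psi> r] by auto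
    then have "percolates \<phi> (boolean_edges \<phi> (2 * r))"
      by (rule percolates_mono[OF that(3) subset_refl])
    then show ?thesis
      using that E(2) by (auto simp: M.space_eq)
  qed
  then have "{(\<phi> :: 'a set, \<psi> :: 'a set). locally_finite \<phi> \<and> locally_finite \<psi> \<and>
      percolates \<phi> (ab_edges \<phi> \<psi> r)} \<subseteq> ?Z"
    by blast
  then show ?thesis
    unfolding ab_perc_prob_def using Z
    by (subst outer_measure_of_eq_0_iff) (auto simp: space_pair_measure L.space_eq M.space_eq)
qed

section \<open>Bounds on the critical intensity\<close>

theorem proposition2p3:
  fixes lam r :: real
  assumes "DIM('a::euclidean_space) \<ge> 2"
    and "lam > 0" and "r > 0"
  shows "(lambda_c TYPE('a) (2 * r) < ereal lam \<and> ereal lam < lambda_c TYPE('a) r \<longrightarrow>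
            mu_c TYPE('a) lam r \<ge> lambda_c TYPE('a) r - ereal lam) \<and>
         (ereal lam < lambda_c TYPE('a) (2 * r) \<longrightarrow> mu_c TYPE('a) lam r = \<infinity>)"
proof (intro conjI impI)
  assume "lambda_c TYPE('a) (2 * r) < ereal lam \<and> ereal lam < lambda_c TYPE('a) r"
  then obtain l0 where l0: "l0 > lam" "boolean_perc_prob TYPE('a) l0 r = 0"
    unfolding lambda_c_def less_Sup_iff by auto
  \<comment> \<open>\<open>lambda_c\<close> may be infinite, so the bound is kept in additive form
    and \<open>lam\<close> is subtracted only at the end.\<close>
  have mu_c_ge: "ereal l \<le> mu_c TYPE('a) lam r + ereal lam"
    if "lam < l" "boolean_perc_prob TYPE('a) l r = 0" for l
  proof -
    have "ab_perc_prob TYPE('a) lam (l - lam) r = 0"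
      using that assms by (intro ab_perc_prob_null_superposition) auto
    then have "ereal (l - lam) \<le> mu_c TYPE('a) lam r"
      unfolding mu_c_def using that by (intro Sup_upper) auto
    then have "ereal (l - lam) + ereal lam \<le> mu_c TYPE('a) lam r + ereal lam"
      by (rule add_right_mono)
    then show ?thesis by simp
  qed
  have "lambda_c TYPE('a) r \<le> mu_c TYPE('a) lam r + ereal lam"
    unfolding lambda_c_def
  proof (rule Sup_least, clarify)
    fix l assume "0 < l" "boolean_perc_prob TYPE('a) l r = 0"
    \<comment> \<open>An intensity \<open>l\<close> not above \<open>lam\<close> leaves no positive
      difference \<open>l - lam\<close>; it lies below \<open>l0\<close>, for which the bound is
      known.\<close>
    then show "ereal l \<le> mu_c TYPE('a) lam r + ereal lam"
      using mu_c_ge[of l] order.trans[OF _ mu_c_ge[OF l0], of "ereal l"] l0(1)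
      by (cases "lam < l") auto
  qed
  then show "lambda_c TYPE('a) r - ereal lam \<le> mu_c TYPE('a) lam r"
    by (simp add: ereal_minus_le)
next
  assume "ereal lam < lambda_c TYPE('a) (2 * r)"
  then obtain l0 where l0: "l0 > lam" "boolean_perc_prob TYPE('a) l0 (2 * r) = 0"
    unfolding lambda_c_def less_Sup_iff by auto
  then have "boolean_perc_prob TYPE('a) lam (2 * r) = 0"
    using assms(2) by (intro boolean_perc_prob_null_mono[OF assms(2) l0])
  then have ge: "ereal \<mu> \<le> mu_c TYPE('a) lam r" if "\<mu> > 0" for \<mu>
    unfolding mu_c_def using that ab_perc_prob_null_boolean[OF assms(2) that] by (intro Sup_upper) auto
  show "mu_c TYPE('a) lam r = \<infinity>"
  proof (rule ereal_top)
    fix K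
    \<comment> \<open>The maximum with 1 gives a positive intensity, as the set defining
      \<open>mu_c\<close> demands.\<close>
    have "ereal K \<le> ereal (max K 1)" by simp
    also have "\<dots> \<le> mu_c TYPE('a) lam r" by (rule ge) simp
    finally show "ereal K \<le> mu_c TYPE('a) lam r" .
  qed
qed

end
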